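(* Let $G$ be a non-elementary Gromov-hyperbolic group with Cayley graph $\Gamma$ (with respect to a finite symmetric generating set), and consider first passage percolation on $\Gamma$ with i.i.d. edge lengths of law $\rho$, where $\rho$ has no atoms and $\int_0^\infty e^{ax}\,d\rho(x)<\infty$ for some $a>0$. Then there exists a full measure subset $\Omega_2\subset\Omega$ such that for all $\omega\in\Omega_2$ and all $\xi_1\neq\xi_2\in\partial G$ there exists a bi-infinite $\omega$-geodesic $(\xi_1,\xi_2)_\omega$ joining $\xi_1$ and $\xi_2$.
   Context: $\Gamma$ has edge set $E$ and is equipped with the word metric $d$; $\partial G$ is the Gromov boundary. The configuration space is $\Omega=[0,\infty)^E$ with product measure $\mathbb{P}=\rho^{\otimes E}$. For $\omega\in\Omega$, $d_\omega(x,y)=\inf_{\gamma:x\to y}\sum_{e\in\gamma}\omega(e)$ over edge paths from $x$ to $y$. A finite path is an $\omega$-geodesic if it attains $d_\omega$ between its endpoints. A semi-infinite (resp. bi-infinite) path is an $\omega$-geodesic ray (resp. a bi-infinite $\omega$-geodesic) if every finite subpath is an $\omega$-geodesic. An $\omega$-geodesic ray has direction $\xi\in\partial G$ if $\xi$ is its only accumulation point in $\partial G$ (in the Gromov compactification $\Gamma\cup\partial G$). A bi-infinite $\omega$-geodesic $(\xi_1,\xi_2)_\omega$ joins $\xi_1$ and $\xi_2$ if its two ends (half-rays) have directions $\xi_1$ and $\xi_2$ respectively. *)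

theory Defs
  imports "HOL-Algebra.Algebra" "HOL-Probability.Probability"
begin

section \<open>Cayley graphs and word metrics\<close>

definition finite_symmetric_generating_set :: "('a, 'b) monoid_scheme \<Rightarrow> 'a set \<Rightarrow> bool" where
  "finite_symmetric_generating_set G S \<longleftrightarrow>
     finite S \<and> S \<subseteq> carrier G \<and> (\<forall>s\<in>S. inv\<^bsub>G\<^esub> s \<in> S) \<and> generate G S = carrier G"

text \<open>The Cayley graph is undirected and simple: since \<open>S\<close> is symmetric, the generators \<open>s\<close> and
  \<open>s\<^sup>-\<^sup>1\<close> give the same edge, and a unit element in \<open>S\<close> does not create loops.\<close>

definition cayley_edges :: "('a, 'b) monoid_scheme \<Rightarrow> 'a set \<Rightarrow> 'a set set" where
  "cayley_edges G S = {{x, x \<otimes>\<^bsub>G\<^esub> s} | x s. x \<in> carrier G \<and> s \<in> S \<and> s \<noteq> \<one>\<^bsub>G\<^esub>}"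

definition word_length :: "('a, 'b) monoid_scheme \<Rightarrow> 'a set \<Rightarrow> 'a \<Rightarrow> nat" where
  "word_length G S g =
     (LEAST n. \<exists>ws. set ws \<subseteq> S \<and> length ws = n \<and> foldr (\<otimes>\<^bsub>G\<^esub>) ws \<one>\<^bsub>G\<^esub> = g)"

definition word_dist :: "('a, 'b) monoid_scheme \<Rightarrow> 'a set \<Rightarrow> 'a \<Rightarrow> 'a \<Rightarrow> real" where
  "word_dist G S x y = real (word_length G S (inv\<^bsub>G\<^esub> x \<otimes>\<^bsub>G\<^esub> y))"


section \<open>Hyperbolicity and the Gromov boundary\<close>

definition gromov_product :: "('a, 'b) monoid_scheme \<Rightarrow> 'a set \<Rightarrow> 'a \<Rightarrow> 'a \<Rightarrow> 'a \<Rightarrow> real" where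
  "gromov_product G S w x y = (word_dist G S w x + word_dist G S w y - word_dist G S x y) / 2"

definition gromov_hyperbolic_group :: "('a, 'b) monoid_scheme \<Rightarrow> 'a set \<Rightarrow> bool" where
  "gromov_hyperbolic_group G S \<longleftrightarrow>
     (\<exists>\<delta>\<ge>0. \<forall>w\<in>carrier G. \<forall>x\<in>carrier G. \<forall>y\<in>carrier G. \<forall>z\<in>carrier G.
        gromov_product G S w x z
          \<ge> min (gromov_product G S w x y) (gromov_product G S w y z) - \<delta>)"

text \<open>Elementary means virtually cyclic; finite groups are included, through the trivial
  subgroup.\<close>

definition elementary_group :: "('a, 'b) monoid_scheme \<Rightarrow> bool" where
  "elementary_group G \<longleftrightarrow>
     (\<exists>H. subgroup H G \<and> cyclic_group (G\<lparr>carrier := H\<rparr>) \<and> finite (rcosets\<^bsub>G\<^esub> H))"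

text \<open>The boundary is the set of classes of sequences converging at infinity, that is, with
  \<open>(x\<^sub>i | x\<^sub>j) \<rightarrow> \<infinity>\<close>, where two such sequences are equivalent if \<open>(x\<^sub>i | y\<^sub>j) \<rightarrow> \<infinity>\<close>,
  as \<open>i, j \<rightarrow> \<infinity>\<close> independently.\<close>

definition gromov_close ::
    "('a, 'b) monoid_scheme \<Rightarrow> 'a set \<Rightarrow> (nat \<Rightarrow> 'a) \<Rightarrow> (nat \<Rightarrow> 'a) \<Rightarrow> bool" where
  "gromov_close G S x y \<longleftrightarrow>
     filterlim (\<lambda>(i, j). gromov_product G S \<one>\<^bsub>G\<^esub> (x i) (y j)) at_top (sequentially \<times>\<^sub>F sequentially)"

definition gromov_sequences :: "('a, 'b) monoid_scheme \<Rightarrow> 'a set \<Rightarrow> (nat \<Rightarrow> 'a) set" where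
  "gromov_sequences G S = {x. range x \<subseteq> carrier G \<and> gromov_close G S x x}"

definition gromov_boundary :: "('a, 'b) monoid_scheme \<Rightarrow> 'a set \<Rightarrow> (nat \<Rightarrow> 'a) set set" where
  "gromov_boundary G S =
     gromov_sequences G S //
       {(x, y). x \<in> gromov_sequences G S \<and> y \<in> gromov_sequences G S \<and> gromov_close G S x y}"

text \<open>In the Gromov compactification a sequence of vertices converges to a boundary point \<open>\<eta>\<close>
  iff it belongs to the class \<open>\<eta>\<close>; the compactification is metrizable, so accumulation points are
  limits of subsequences. The interior points of the edges of a path do not change its
  accumulation points in the boundary.\<close>

definition accumulation_points ::
    "('a, 'b) monoid_scheme \<Rightarrow> 'a set \<Rightarrow> (nat \<Rightarrow> 'a) \<Rightarrow> (nat \<Rightarrow> 'a) set set" where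
  "accumulation_points G S p =
     {\<eta> \<in> gromov_boundary G S. \<exists>r. strict_mono r \<and> p \<circ> r \<in> \<eta>}"

definition has_direction ::
    "('a, 'b) monoid_scheme \<Rightarrow> 'a set \<Rightarrow> (nat \<Rightarrow> 'a) \<Rightarrow> (nat \<Rightarrow> 'a) set \<Rightarrow> bool" where
  "has_direction G S p \<xi> \<longleftrightarrow> accumulation_points G S p = {\<xi>}"


section \<open>First passage percolation\<close>

text \<open>A finite edge path is represented by the nonempty list of its successive vertices.\<close>

definition edge_path :: "('a, 'b) monoid_scheme \<Rightarrow> 'a set \<Rightarrow> 'a list \<Rightarrow> bool" where
  "edge_path G S ps \<longleftrightarrow>
     ps \<noteq> [] \<and> set ps \<subseteq> carrier G \<and> successively (\<lambda>u v. {u, v} \<in> cayley_edges G S) ps"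

definition fpp_length :: "('a set \<Rightarrow> real) \<Rightarrow> 'a list \<Rightarrow> real" where
  "fpp_length \<omega> ps = (\<Sum>i<length ps - 1. \<omega> {ps ! i, ps ! Suc i})"

definition fpp_dist ::
    "('a, 'b) monoid_scheme \<Rightarrow> 'a set \<Rightarrow> ('a set \<Rightarrow> real) \<Rightarrow> 'a \<Rightarrow> 'a \<Rightarrow> real" where
  "fpp_dist G S \<omega> x y = (INF ps\<in>{ps. edge_path G S ps \<and> hd ps = x \<and> last ps = y}. fpp_length \<omega> ps)"

definition fpp_geodesic ::
    "('a, 'b) monoid_scheme \<Rightarrow> 'a set \<Rightarrow> ('a set \<Rightarrow> real) \<Rightarrow> 'a list \<Rightarrow> bool" where
  "fpp_geodesic G S \<omega> ps \<longleftrightarrow>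
     edge_path G S ps \<and> fpp_length \<omega> ps = fpp_dist G S \<omega> (hd ps) (last ps)"

definition bi_infinite_geodesic ::
    "('a, 'b) monoid_scheme \<Rightarrow> 'a set \<Rightarrow> ('a set \<Rightarrow> real) \<Rightarrow> (int \<Rightarrow> 'a) \<Rightarrow> bool" where
  "bi_infinite_geodesic G S \<omega> p \<longleftrightarrow> (\<forall>i j. i \<le> j \<longrightarrow> fpp_geodesic G S \<omega> (map p [i..j]))"

definition joins ::
    "('a, 'b) monoid_scheme \<Rightarrow> 'a set \<Rightarrow> (int \<Rightarrow> 'a) \<Rightarrow> (nat \<Rightarrow> 'a) set \<Rightarrow> (nat \<Rightarrow> 'a) set \<Rightarrow> bool" where
  "joins G S p \<xi>\<^sub>1 \<xi>\<^sub>2 \<longleftrightarrow>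
     has_direction G S (\<lambda>n. p (- int n)) \<xi>\<^sub>1 \<and> has_direction G S (\<lambda>n. p (int n)) \<xi>\<^sub>2"

definition fpp_measure ::
    "('a, 'b) monoid_scheme \<Rightarrow> 'a set \<Rightarrow> real measure \<Rightarrow> ('a set \<Rightarrow> real) measure" where
  "fpp_measure G S \<rho> = PiM (cayley_edges G S) (\<lambda>_. \<rho>)"

end

(* Chernoff bounds and a union bound over self-avoiding paths show that almost surely, for all
   n >= N(omega), every self-avoiding path that starts in the ball B(1, n) has omega-length at least
   c n if it has n edges, and at most C n if it has at most n edges. So omega-geodesics behave like
   quasigeodesics at every scale D that is large and at least a fixed fraction of the distance to 1.
   The classical proof of the Morse lemma, applied at the point p of a word geodesic [x, y] that
   maximizes d(p, gamma) - |p|/4, then gives d(p, gamma) <= M(omega) + |p|/4 for every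
   omega-geodesic gamma from x to y and every p in [x, y].

   Let x_i and y_i converge to two distinct boundary points. Their word geodesics meet a fixed ball,
   hence so do the omega-geodesics from x_i to y_i, and a subsequence of these converges. Applied to
   final segments, the Morse lemma shows that a point z far along such an omega-geodesic has a large
   Gromov product with y_i, uniformly in i; this gives the directions of the limit. *)

theory Submission
  imports Defs "HOL-Real_Asymp.Real_Asymp" "HOL-Library.Diagonal_Subsequence"
begin

section \<open>Word metric\<close>

text \<open>There may be uncountably many pairs of boundary points, so the exceptional null set must
  not depend on them: only the two path bounds are random, and once they hold for \<omega> the
  argument is deterministic. A single \<open>N\<close> cannot be expected to serve paths starting
  anywhere, since far from the identity there may be arbitrarily bad regions; a start in B(1, n) is
  what a union bound over exponentially many paths can afford at scale n. This forces the term |p|/4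
  in the Morse error, which is harmless because the lemma is only used at points p in a bounded
  ball. The slope 1/4 is such that a move of 4 D along the word geodesic raises the permitted error
  by at most D. Self-avoiding paths have distinct edges, hence independent weights. Since \<rho> has
  no atom at 0, its Laplace transform becomes small enough to beat the number of paths; the
  exponential moment plays this part for the upper bound.\<close>

locale cayley_graph = group G for G :: "('a, 'b) monoid_scheme" (structure) +
  fixes S :: "'a set"
  assumes generating: "finite_symmetric_generating_set G S"
begin

lemma mult_inv_cancel: "x \<in> carrier G \<Longrightarrow> y \<in> carrier G \<Longrightarrow> x \<otimes> (inv x \<otimes> y) = y"
  by (simp add: m_assoc[symmetric])

lemma inv_mult_cancel: "x \<in> carrier G \<Longrightarrow> y \<in> carrier G \<Longrightarrow> inv x \<otimes> (x \<otimes> y) = y"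
  by (simp add: m_assoc[symmetric])

lemma finite_gen: "finite S" and gen_carrier: "S \<subseteq> carrier G"
  and gen_inv: "s \<in> S \<Longrightarrow> inv s \<in> S" and generate_gen: "generate G S = carrier G"
  using generating by (auto simp: finite_symmetric_generating_set_def)

abbreviation word_prod :: "'a list \<Rightarrow> 'a" where
  "word_prod ws \<equiv> foldr (\<otimes>) ws \<one>"

lemma word_prod_closed [simp]: "set ws \<subseteq> carrier G \<Longrightarrow> word_prod ws \<in> carrier G"
  by (induction ws) auto

lemma word_prod_append:
  "set us \<subseteq> carrier G \<Longrightarrow> set ws \<subseteq> carrier G \<Longrightarrow> word_prod (us @ ws) = word_prod us \<otimes> word_prod ws"
proof (induction us)
  case (Cons a us)
  then show ?case by (simp add: m_assoc)
qed simp

lemma word_prod_inv: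
  "set ws \<subseteq> carrier G \<Longrightarrow> word_prod (map (m_inv G) (rev ws)) = inv (word_prod ws)"
proof (induction ws)
  case (Cons a ws)
  have "set (map (m_inv G) (rev ws)) \<subseteq> carrier G" using Cons.prems by auto
  then have "word_prod (map (m_inv G) (rev ws) @ [inv a]) = inv (word_prod ws) \<otimes> inv a"
    using Cons by (subst word_prod_append) auto
  then show ?case using Cons.prems by (simp add: inv_mult_group)
qed simp

lemma ex_word:
  assumes "g \<in> carrier G"
  shows "\<exists>ws. set ws \<subseteq> S \<and> word_prod ws = g"
proof -
  have "g \<in> generate G S" using assms generate_gen by simp
  then show ?thesis
  proof (induction rule: generate.induct)
    case one
    then show ?case by (intro exI[of _ "[]"]) auto
  next
    case (incl h)
    then show ?case using gen_carrier by (intro exI[of _ "[h]"]) auto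
  next
    case (inv h)
    then show ?case using gen_carrier gen_inv[OF inv] by (intro exI[of _ "[inv h]"]) auto
  next
    case (eng h1 h2)
    then obtain u v where "set u \<subseteq> S" "word_prod u = h1" "set v \<subseteq> S" "word_prod v = h2" by blast
    then show ?case using gen_carrier by (intro exI[of _ "u @ v"]) (subst word_prod_append, auto)
  qed
qed

abbreviation wlen :: "'a \<Rightarrow> nat" where "wlen \<equiv> word_length G S"

lemma wlen_le: "set ws \<subseteq> S \<Longrightarrow> wlen (word_prod ws) \<le> length ws"
  unfolding word_length_def by (intro Least_le) auto

lemma wlen_attained:
  assumes "g \<in> carrier G"
  obtains ws where "set ws \<subseteq> S" "length ws = wlen g" "word_prod ws = g"
proof -
  have "\<exists>n ws. set ws \<subseteq> S \<and> length ws = n \<and> word_prod ws = g"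
    using ex_word[OF assms] by blast
  then have "\<exists>ws. set ws \<subseteq> S \<and> length ws = wlen g \<and> word_prod ws = g"
    unfolding word_length_def by (rule LeastI_ex)
  then show thesis using that by blast
qed

lemma wlen_one [simp]: "wlen \<one> = 0"
  using wlen_le[of "[]"] by simp

lemma wlen_eq_0:
  assumes "g \<in> carrier G" shows "wlen g = 0 \<longleftrightarrow> g = \<one>"
proof -
  obtain ws where "set ws \<subseteq> S" "length ws = wlen g" "word_prod ws = g" using wlen_attained[OF assms] .
  then show ?thesis by auto
qed

lemma wlen_mult:
  assumes "g \<in> carrier G" "h \<in> carrier G" shows "wlen (g \<otimes> h) \<le> wlen g + wlen h"
proof -
  obtain u where u: "set u \<subseteq> S" "length u = wlen g" "word_prod u = g" using wlen_attained assms by blast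
  obtain v where v: "set v \<subseteq> S" "length v = wlen h" "word_prod v = h" using wlen_attained assms by blast
  have "word_prod (u @ v) = g \<otimes> h" using u v gen_carrier by (subst word_prod_append) auto
  then show ?thesis using wlen_le[of "u @ v"] u v by auto
qed

lemma wlen_inv_le: assumes "g \<in> carrier G" shows "wlen (inv g) \<le> wlen g"
proof -
  obtain u where u: "set u \<subseteq> S" "length u = wlen g" "word_prod u = g" using wlen_attained assms by blast
  have "word_prod (map (m_inv G) (rev u)) = inv g" using u gen_carrier by (subst word_prod_inv) auto
  moreover have "set (map (m_inv G) (rev u)) \<subseteq> S" using u gen_inv by auto
  ultimately show ?thesis using wlen_le u by (metis length_map length_rev)
qed

lemma wlen_inv: "g \<in> carrier G \<Longrightarrow> wlen (inv g) = wlen g"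
  by (metis inv_closed inv_inv le_antisym wlen_inv_le)

lemma wlen_gen: "s \<in> S \<Longrightarrow> wlen s \<le> 1"
  using wlen_le[of "[s]"] gen_carrier by auto

text \<open>The word metric before its coercion to the reals, so that distances can serve as indices
  and be inducted on.\<close>

definition wd :: "'a \<Rightarrow> 'a \<Rightarrow> nat" where
  "wd x y = wlen (inv x \<otimes> y)"

lemma word_dist_wd: "word_dist G S x y = real (wd x y)"
  by (simp add: word_dist_def wd_def)

lemma wd_refl [simp]: "x \<in> carrier G \<Longrightarrow> wd x x = 0"
  by (simp add: wd_def)

lemma wd_eq_0: "x \<in> carrier G \<Longrightarrow> y \<in> carrier G \<Longrightarrow> wd x y = 0 \<longleftrightarrow> x = y"
  using wlen_eq_0[of "inv x \<otimes> y"] mult_inv_cancel[of x y] by (auto simp: wd_def)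

lemma wd_sym: "x \<in> carrier G \<Longrightarrow> y \<in> carrier G \<Longrightarrow> wd x y = wd y x"
  unfolding wd_def using wlen_inv[of "inv x \<otimes> y"] by (simp add: inv_mult_group)

lemma wd_triangle:
  assumes "x \<in> carrier G" "y \<in> carrier G" "z \<in> carrier G" shows "wd x z \<le> wd x y + wd y z"
proof -
  have "inv x \<otimes> z = (inv x \<otimes> y) \<otimes> (inv y \<otimes> z)"
    using assms by (simp add: m_assoc mult_inv_cancel)
  then show ?thesis unfolding wd_def using wlen_mult assms by simp
qed

abbreviation edge :: "'a \<Rightarrow> 'a \<Rightarrow> bool" where
  "edge u v \<equiv> {u, v} \<in> cayley_edges G S"

text \<open>The set \<open>{u, v}\<close> carries no orientation, so its generator may lead from
  \<open>v\<close> to \<open>u\<close>; closure of \<open>S\<close> under inverses turns it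
  round.\<close>

lemma edge_iff:
  assumes "u \<in> carrier G" "v \<in> carrier G"
  shows "edge u v \<longleftrightarrow> u \<noteq> v \<and> inv u \<otimes> v \<in> S"
proof
  assume "edge u v"
  then obtain x s where x: "x \<in> carrier G" "s \<in> S" "s \<noteq> \<one>" "{u, v} = {x, x \<otimes> s}"
    by (auto simp: cayley_edges_def)
  have s: "s \<in> carrier G" using x gen_carrier by auto
  have ne: "x \<noteq> x \<otimes> s"
  proof
    assume "x = x \<otimes> s"
    then have "inv x \<otimes> x = s" using inv_mult_cancel[OF x(1) s] by simp
    then show False using x by simp
  qed
  consider "u = x" "v = x \<otimes> s" | "u = x \<otimes> s" "v = x"
    using x(4) unfolding doubleton_eq_iff by blast
  then show "u \<noteq> v \<and> inv u \<otimes> v \<in> S"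
  proof cases
    case 1
    show ?thesis unfolding 1 inv_mult_cancel[OF x(1) s] using ne x(2) by blast
  next
    case 2
    have "inv (x \<otimes> s) \<otimes> x = inv s" using x(1) s by (simp add: inv_mult_group m_assoc)
    then show ?thesis unfolding 2 using gen_inv[OF x(2)] ne by metis
  qed
next
  assume *: "u \<noteq> v \<and> inv u \<otimes> v \<in> S"
  have "inv u \<otimes> v \<noteq> \<one>"
    using * assms mult_inv_cancel[of u v] by auto
  then show "edge u v" unfolding cayley_edges_def
    using * assms mult_inv_cancel[of u v]
    by (intro CollectI exI[of _ u] exI[of _ "inv u \<otimes> v"]) simp
qed

lemma edge_wd: "u \<in> carrier G \<Longrightarrow> v \<in> carrier G \<Longrightarrow> edge u v \<Longrightarrow> wd u v \<le> 1"
  using wlen_gen by (simp add: edge_iff wd_def)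

lemma wd_word: "x \<in> carrier G \<Longrightarrow> set ws \<subseteq> S \<Longrightarrow> wd x (x \<otimes> word_prod ws) \<le> length ws"
proof -
  assume x: "x \<in> carrier G" and ws: "set ws \<subseteq> S"
  have "word_prod ws \<in> carrier G" using ws gen_carrier by auto
  then have "inv x \<otimes> (x \<otimes> word_prod ws) = word_prod ws" using x by (simp add: inv_mult_cancel)
  then show ?thesis unfolding wd_def using wlen_le[OF ws] by simp
qed

text \<open>The step is the first letter of a shortest word for \<open>inv x \<otimes> y\<close>.
  The other letters bound the remaining distance by \<open>n\<close>, and one edge cannot gain more
  than 1.\<close>

lemma wd_step:
  assumes "x \<in> carrier G" "y \<in> carrier G" "wd x y = Suc n"
  obtains z where "z \<in> carrier G" "edge x z" "wd z y = n"
proof -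
  obtain ws where ws: "set ws \<subseteq> S" "length ws = Suc n" "word_prod ws = inv x \<otimes> y"
    using wlen_attained[of "inv x \<otimes> y"] assms unfolding wd_def by auto
  obtain s us where su: "ws = s # us" using ws by (cases ws) auto
  have s: "s \<in> S" "s \<in> carrier G" "set us \<subseteq> S" using su ws gen_carrier by auto
  have uc: "word_prod us \<in> carrier G" using s gen_carrier by auto
  define z where "z = x \<otimes> s"
  have z: "z \<in> carrier G" using assms s z_def by auto
  have "y = x \<otimes> (s \<otimes> word_prod us)" using ws su assms s uc
    using mult_inv_cancel[of x y] by simp
  then have y: "y = z \<otimes> word_prod us" using assms s uc by (simp add: z_def m_assoc)
  have le: "wd z y \<le> n" unfolding y using wd_word[OF z s(3)] su ws by simp
  have xs: "inv x \<otimes> z = s" unfolding z_def using assms s by (simp add: inv_mult_cancel)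
  have "wd x z \<le> 1" unfolding wd_def xs using wlen_gen s by simp
  then have eq: "wd z y = n" using wd_triangle[OF assms(1) z assms(2)] le assms by simp
  then have "x \<noteq> z" using assms by auto
  then have "edge x z" using edge_iff assms z xs s by simp
  then show thesis using that z eq by blast
qed

definition wgeod :: "(nat \<Rightarrow> 'a) \<Rightarrow> nat \<Rightarrow> bool" where
  "wgeod g n \<longleftrightarrow> (\<forall>i\<le>n. g i \<in> carrier G) \<and> (\<forall>i<n. edge (g i) (g (Suc i))) \<and>
     (\<forall>i\<le>n. \<forall>j\<le>n. i \<le> j \<longrightarrow> wd (g i) (g j) = j - i)"

lemma wd_path_le:
  assumes "\<And>i. i \<le> n \<Longrightarrow> g i \<in> carrier G" "\<And>i. i < n \<Longrightarrow> edge (g i) (g (Suc i))" "i \<le> j" "j \<le> n"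
  shows "wd (g i) (g j) \<le> j - i"
  using assms(3,4)
proof (induction j rule: dec_induct)
  case base
  then show ?case using assms by simp
next
  case (step m)
  have "wd (g i) (g (Suc m)) \<le> wd (g i) (g m) + wd (g m) (g (Suc m))"
    using step assms by (intro wd_triangle) auto
  also have "\<dots> \<le> (m - i) + 1" using step assms by (intro add_mono edge_wd) auto
  finally show ?case using step by simp
qed

lemma ex_wgeod:
  assumes "x \<in> carrier G" "y \<in> carrier G"
  obtains g where "wgeod g (wd x y)" "g 0 = x" "g (wd x y) = y"
proof -
  define n where "n = wd x y"
  have "\<exists>g. g 0 = x \<and> g n = y \<and> (\<forall>i\<le>n. g i \<in> carrier G) \<and> (\<forall>i<n. edge (g i) (g (Suc i)))"
    using n_def[symmetric] assms(1)
  proof (induction n arbitrary: x)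
    case 0
    then show ?case using wd_eq_0 assms by (intro exI[of _ "\<lambda>_. x"]) auto
  next
    case (Suc n)
    obtain z where z: "z \<in> carrier G" "edge x z" "wd z y = n" using wd_step Suc assms by metis
    obtain g where g: "g 0 = z" "g n = y" "\<forall>i\<le>n. g i \<in> carrier G" "\<forall>i<n. edge (g i) (g (Suc i))"
      using Suc.IH[OF z(3,1)] by blast
    have "\<forall>i\<le>Suc n. case_nat x g i \<in> carrier G" using g Suc by (auto split: nat.split)
    moreover have "\<forall>i<Suc n. edge (case_nat x g i) (case_nat x g (Suc i))"
      using g z by (auto split: nat.split)
    ultimately show ?case using g by (intro exI[of _ "case_nat x g"]) auto
  qed
  then obtain g where g: "g 0 = x" "g n = y" "\<And>i. i\<le>n \<Longrightarrow> g i \<in> carrier G" "\<And>i. i<n \<Longrightarrow> edge (g i) (g (Suc i))"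
    by blast
  \<comment> \<open>Each of the three pieces cut off at \<open>i\<close> and \<open>j\<close> spans
    at most its number of edges. These numbers add up to the distance \<open>n\<close> of the
    endpoints, so no piece can fall short.\<close>
  have "wd (g i) (g j) = j - i" if "i \<le> j" "j \<le> n" for i j
  proof -
    have "n \<le> wd (g 0) (g i) + wd (g i) (g n)"
      using wd_triangle[of "g 0" "g i" "g n"] g that n_def by auto
    moreover have "wd (g i) (g n) \<le> wd (g i) (g j) + wd (g j) (g n)"
      using g that by (intro wd_triangle) auto
    moreover have "wd (g 0) (g i) \<le> i" "wd (g i) (g j) \<le> j - i" "wd (g j) (g n) \<le> n - j"
      using wd_path_le[of n g 0 i] wd_path_le[of n g i j] wd_path_le[of n g j n] g that by auto
    ultimately show ?thesis using that by linarith
  qed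
  then have "wgeod g n" unfolding wgeod_def using g by auto
  then show thesis using that g n_def by auto
qed

abbreviation gp :: "'a \<Rightarrow> 'a \<Rightarrow> 'a \<Rightarrow> real" where
  "gp w x y \<equiv> gromov_product G S w x y"

lemma gp_def: "gp w x y = (real (wd w x) + real (wd w y) - real (wd x y)) / 2"
  by (simp add: gromov_product_def word_dist_wd)

lemma gp_sym: "x \<in> carrier G \<Longrightarrow> y \<in> carrier G \<Longrightarrow> gp w x y = gp w y x"
  using wd_sym by (simp add: gp_def)

lemma gp_self: "x \<in> carrier G \<Longrightarrow> gp w x x = real (wd w x)"
  by (simp add: gp_def)

text \<open>The source of compactness, for the minimization in \<open>ex_geod\<close> and for the
  limit in \<open>ex_bi_infinite_geodesic\<close>.\<close>

lemma finite_word_ball: "finite {x \<in> carrier G. wd \<one> x \<le> n}"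
proof (rule finite_subset)
  show "{x \<in> carrier G. wd \<one> x \<le> n} \<subseteq> word_prod ` {ws. set ws \<subseteq> S \<and> length ws \<le> n}"
  proof
    fix x assume "x \<in> {x \<in> carrier G. wd \<one> x \<le> n}"
    then have x: "x \<in> carrier G" "wlen x \<le> n" by (auto simp: wd_def)
    then show "x \<in> word_prod ` {ws. set ws \<subseteq> S \<and> length ws \<le> n}"
      using wlen_attained[OF x(1)] by (metis (mono_tags, lifting) image_iff mem_Collect_eq)
  qed
  show "finite (word_prod ` {ws. set ws \<subseteq> S \<and> length ws \<le> n})"
    using finite_lists_length_le[OF finite_gen] by auto
qed

lemma edge_sym: "edge u v \<longleftrightarrow> edge v u"
  by (simp add: insert_commute)

lemma edge_path_iff:
  "edge_path G S ps \<longleftrightarrow> ps \<noteq> [] \<and> set ps \<subseteq> carrier G \<and> (\<forall>i. Suc i < length ps \<longrightarrow> edge (ps ! i) (ps ! Suc i))"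
  by (simp add: edge_path_def successively_conv_nth)

lemma edge_path_append:
  "us \<noteq> [] \<Longrightarrow> vs \<noteq> [] \<Longrightarrow>
    edge_path G S (us @ vs) \<longleftrightarrow> edge_path G S us \<and> edge_path G S vs \<and> edge (last us) (hd vs)"
  by (auto simp: edge_path_def successively_append_iff)

lemma edge_path_rev: "edge_path G S ps \<Longrightarrow> edge_path G S (rev ps)"
  by (auto simp: edge_path_def edge_sym)

lemma wgeod_edge_path:
  assumes "wgeod g n"
  shows "edge_path G S (map g [0..<Suc n])" "distinct (map g [0..<Suc n])"
proof -
  show "edge_path G S (map g [0..<Suc n])"
    using assms by (auto simp: edge_path_iff wgeod_def nth_append simp del: upt_Suc)
  have "inj_on g {..n}"
  proof (rule linorder_inj_onI')
    fix i j assume "i \<in> {..n}" "j \<in> {..n}" "i < j"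
    then have "wd (g i) (g j) = j - i" "i < j" "g i \<in> carrier G" using assms by (auto simp: wgeod_def)
    then show "g i \<noteq> g j" by auto
  qed
  then show "distinct (map g [0..<Suc n])" by (simp add: distinct_map atLeast0_lessThan_Suc lessThan_Suc_atMost atLeast0LessThan del: upt_Suc)
qed

lemma ex_distinct_path:
  assumes "x \<in> carrier G" "y \<in> carrier G"
  obtains ps where "edge_path G S ps" "distinct ps" "hd ps = x" "last ps = y" "length ps = Suc (wd x y)"
proof -
  obtain g where g: "wgeod g (wd x y)" "g 0 = x" "g (wd x y) = y" using ex_wgeod assms by blast
  show thesis
    by (rule that[of "map g [0..<Suc (wd x y)]"])
      (use wgeod_edge_path[OF g(1)] g in \<open>auto simp: hd_map last_map simp del: upt_Suc\<close>)
qed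

end

section \<open>Geodesics of first passage percolation\<close>

lemma fpp_length_single [simp]: "fpp_length \<omega> [a] = 0"
  by (simp add: fpp_length_def)

lemma fpp_length_Cons: "fpp_length \<omega> (a # b # ps) = \<omega> {a, b} + fpp_length \<omega> (b # ps)"
  by (simp add: fpp_length_def sum.lessThan_Suc_shift del: sum.lessThan_Suc)

lemma fpp_length_append:
  "us \<noteq> [] \<Longrightarrow> vs \<noteq> [] \<Longrightarrow>
    fpp_length \<omega> (us @ vs) = fpp_length \<omega> us + \<omega> {last us, hd vs} + fpp_length \<omega> vs"
proof (induction us rule: induct_list012)
  case (2 x)
  then show ?case by (cases vs) (auto simp: fpp_length_Cons)
next
  case (3 x y zs)
  then show ?case by (simp add: fpp_length_Cons)
qed simp

lemma fpp_length_overlap: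
  "fpp_length \<omega> (us @ [y] @ vs) = fpp_length \<omega> (us @ [y]) + fpp_length \<omega> (y # vs)"
proof (induction us rule: induct_list012)
  case (2 x)
  then show ?case by (simp add: fpp_length_Cons)
next
  case (3 x z zs)
  then show ?case by (simp add: fpp_length_Cons)
qed simp

lemma fpp_length_rev: "fpp_length \<omega> (rev ps) = fpp_length \<omega> ps"
proof (induction ps rule: induct_list012)
  case (3 x y zs)
  have "fpp_length \<omega> (rev (y # zs) @ [x]) = fpp_length \<omega> (rev (y # zs)) + \<omega> {y, x}"
    by (subst fpp_length_append) (auto simp: last_rev)
  then show ?case using 3 by (simp add: fpp_length_Cons insert_commute)
qed auto

locale weighted_cayley_graph = cayley_graph G S for G :: "('a, 'b) monoid_scheme" (structure) and S +
  fixes \<omega> :: "'a set \<Rightarrow> real"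
  assumes weight_nonneg: "e \<in> cayley_edges G S \<Longrightarrow> 0 \<le> \<omega> e"
begin

abbreviation len :: "'a list \<Rightarrow> real" where "len \<equiv> fpp_length \<omega>"

lemma len_nonneg: "edge_path G S ps \<Longrightarrow> 0 \<le> len ps"
  unfolding fpp_length_def edge_path_iff by (intro sum_nonneg weight_nonneg) auto

text \<open>The almost sure bounds concern self-avoiding paths only, so arbitrary competitors are
  first made self-avoiding. Cutting out a loop cannot lengthen a path because weights are
  nonnegative.\<close>

lemma loop_erasure:
  assumes "edge_path G S ps"
  shows "\<exists>qs. edge_path G S qs \<and> distinct qs \<and> hd qs = hd ps \<and> last qs = last ps \<and> len qs \<le> len ps"
  using assms
proof (induction "length ps" arbitrary: ps rule: less_induct)
  case less
  show ?case
  proof (cases "distinct ps")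
    case False
    then obtain xs ys zs y where ps: "ps = xs @ [y] @ ys @ [y] @ zs"
      using not_distinct_decomp by blast
    define qs where "qs = xs @ [y] @ zs"
    have e: "edge_path G S (xs @ [y])" "edge_path G S ((y # ys) @ [y])" "edge_path G S ([y] @ zs)"
      using less.prems unfolding ps edge_path_def
      by (auto simp: successively_append_iff successively_Cons hd_append split: if_splits)
    have qs: "edge_path G S qs" using e unfolding qs_def edge_path_def
      by (auto simp: successively_append_iff successively_Cons)
    \<comment> \<open>The discarded loop is \<open>(y # ys) @ [y]\<close>. Consecutive pieces share
      the vertex \<open>y\<close>, so no connecting edge appears in the sum.\<close>
    have "len ps = len (xs @ [y]) + len ((y # ys) @ [y]) + len ([y] @ zs)"
      unfolding ps using fpp_length_overlap[of \<omega> xs y "ys @ [y] @ zs"]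
        fpp_length_overlap[of \<omega> "y # ys" y zs] by simp
    then have "len qs \<le> len ps"
      using fpp_length_overlap[of \<omega> xs y zs] len_nonneg[OF e(2)] by (simp add: qs_def)
    moreover have "hd qs = hd ps" "last qs = last ps" "length qs < length ps"
      unfolding qs_def ps by (cases xs; auto)+
    ultimately show ?thesis using less.hyps[OF _ qs] by force
  qed (use less in auto)
qed

text \<open>Minimality against one competitor at a time avoids handling the infimum in
  \<open>fpp_dist\<close>; \<open>geod_fpp_geodesic\<close> returns to the original notion.\<close>

definition geod :: "'a list \<Rightarrow> bool" where
  "geod ps \<longleftrightarrow> edge_path G S ps \<and>
     (\<forall>qs. edge_path G S qs \<and> hd qs = hd ps \<and> last qs = last ps \<longrightarrow> len ps \<le> len qs)"

lemma geod_edge_path: "geod ps \<Longrightarrow> edge_path G S ps"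
  by (simp add: geod_def)

lemma geod_ne: "geod ps \<Longrightarrow> ps \<noteq> []"
  by (simp add: geod_def edge_path_def)

lemma geod_carrier: "geod ps \<Longrightarrow> set ps \<subseteq> carrier G"
  by (simp add: geod_def edge_path_def)

lemma geod_fpp_geodesic: "geod ps \<Longrightarrow> fpp_geodesic G S \<omega> ps"
  unfolding fpp_geodesic_def fpp_dist_def geod_def
  by (auto intro!: cInf_eq_minimum[symmetric])

text \<open>A cheaper replacement of the middle part, spliced between the same outer parts, would
  beat the whole path.\<close>

lemma geod_infix:
  assumes "geod (us @ vs @ ws)" "vs \<noteq> []"
  shows "geod vs"
  unfolding geod_def
proof (intro conjI allI impI)
  have ep: "edge_path G S (us @ vs @ ws)" using assms geod_edge_path by blast
  then show "edge_path G S vs" using assms(2)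
    by (auto simp: edge_path_def successively_append_iff)
  fix qs assume qs: "edge_path G S qs \<and> hd qs = hd vs \<and> last qs = last vs"
  have ne: "qs \<noteq> []" using qs by (auto simp: edge_path_def)
  have "edge_path G S (us @ qs @ ws)"
    using ep qs ne assms(2) by (auto simp: edge_path_def successively_append_iff)
  moreover have "hd (us @ qs @ ws) = hd (us @ vs @ ws)" "last (us @ qs @ ws) = last (us @ vs @ ws)"
    using qs ne assms(2) by (auto simp: hd_append last_append)
  ultimately have "len (us @ vs @ ws) \<le> len (us @ qs @ ws)"
    using assms(1) by (simp add: geod_def)
  then show "len vs \<le> len qs"
    using qs ne assms(2) by (cases "us = []"; cases "ws = []") (auto simp: fpp_length_append)
qed

lemma geod_rev: "geod ps \<Longrightarrow> geod (rev ps)"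
  unfolding geod_def
proof (intro conjI allI impI)
  assume *: "edge_path G S ps \<and>
    (\<forall>qs. edge_path G S qs \<and> hd qs = hd ps \<and> last qs = last ps \<longrightarrow> len ps \<le> len qs)"
  then show "edge_path G S (rev ps)" by (simp add: edge_path_rev)
  fix qs assume qs: "edge_path G S qs \<and> hd qs = hd (rev ps) \<and> last qs = last (rev ps)"
  have ne: "qs \<noteq> []" "ps \<noteq> []" using qs * by (auto simp: edge_path_def)
  have "edge_path G S (rev qs)" using qs edge_path_rev by blast
  moreover have "hd (rev qs) = hd ps" "last (rev qs) = last ps"
    using qs ne by (auto simp: hd_rev last_rev)
  ultimately have "len ps \<le> len (rev qs)" using * by blast
  then show "len (rev ps) \<le> len qs" by (simp add: fpp_length_rev)
qed

lemma geod_take: "geod ps \<Longrightarrow> geod (take (Suc k) ps)"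
  using geod_infix[of "[]" "take (Suc k) ps" "drop (Suc k) ps"] geod_ne by auto

lemma geod_drop: "geod ps \<Longrightarrow> k < length ps \<Longrightarrow> geod (drop k ps)"
  using geod_infix[of "take k ps" "drop k ps" "[]"] by auto

end

text \<open>Both bounds hold almost surely from some \<open>N\<close> on, by a union bound over the paths.\<close>

locale regular_cayley_graph = weighted_cayley_graph G S \<omega>
  for G :: "('a, 'b) monoid_scheme" (structure) and S and \<omega> +
  fixes N :: nat and c C :: real and \<delta> :: real
  assumes c_pos: "0 < c" and C_pos: "0 < C"
    and lower: "N \<le> n \<Longrightarrow> edge_path G S ps \<Longrightarrow> distinct ps \<Longrightarrow> wd \<one> (hd ps) \<le> n \<Longrightarrow>
      length ps = Suc n \<Longrightarrow> c * n \<le> fpp_length \<omega> ps"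
    and upper: "N \<le> n \<Longrightarrow> edge_path G S ps \<Longrightarrow> distinct ps \<Longrightarrow> wd \<one> (hd ps) \<le> n \<Longrightarrow>
      length ps \<le> Suc n \<Longrightarrow> fpp_length \<omega> ps \<le> C * n"
    and delta_nonneg: "0 \<le> \<delta>"
    and hyperbolic: "w \<in> carrier G \<Longrightarrow> x \<in> carrier G \<Longrightarrow> y \<in> carrier G \<Longrightarrow> z \<in> carrier G \<Longrightarrow>
      min (gp w x y) (gp w y z) - \<delta> \<le> gp w x z"
begin

section \<open>Existence of percolation geodesics and their number of edges\<close>

lemma lower':
  assumes "N \<le> n" "edge_path G S ps" "distinct ps" "wd \<one> (hd ps) \<le> n" "n < length ps"
  shows "c * n \<le> len ps"
proof (cases "length ps = Suc n")
  case False
  \<comment> \<open>The prefix with exactly \<open>n\<close> edges already meets the bound, and the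
    rest has nonnegative length.\<close>
  define us vs where "us = take (Suc n) ps" and "vs = drop (Suc n) ps"
  have ps: "ps = us @ vs" "us \<noteq> []" "vs \<noteq> []" "length us = Suc n"
    using assms False by (auto simp: us_def vs_def)
  then have e: "edge_path G S us" "edge_path G S vs" "edge (last us) (hd vs)" "distinct us" "hd us = hd ps"
    using assms by (auto simp: edge_path_append)
  have "c * n \<le> len us" using lower[OF assms(1) e(1) e(4) _ ps(4)] assms(4) unfolding e(5) .
  also have "\<dots> \<le> len ps"
    unfolding ps(1) fpp_length_append[OF ps(2,3)] using weight_nonneg[OF e(3)] len_nonneg[OF e(2)] by simp
  finally show ?thesis .
qed (use assms lower in auto)

text \<open>The infimum is attained because long self-avoiding paths are expensive: with more than
  \<open>n\<close> vertices they cost more than the competitor \<open>p0\<close>, and only finitely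
  many candidates remain.\<close>

lemma ex_geod:
  assumes "x \<in> carrier G" "y \<in> carrier G"
  obtains ps where "geod ps" "distinct ps" "hd ps = x" "last ps = y"
proof -
  define Q where "Q = {ps. edge_path G S ps \<and> distinct ps \<and> hd ps = x \<and> last ps = y}"
  obtain p0 where p0: "p0 \<in> Q" using ex_distinct_path[OF assms] unfolding Q_def by blast
  obtain n0 :: nat where n0: "len p0 / c < n0" using reals_Archimedean2 by blast
  \<comment> \<open>\<open>n0\<close> makes \<open>c * n\<close> exceed the length of
    \<open>p0\<close>; the other terms make the lower bound at scale \<open>n\<close> available for
    paths from \<open>x\<close>.\<close>
  define n where "n = max n0 (max N (wd \<one> x))"
  define A where "A = {ps \<in> Q. length ps \<le> max n (length p0)}"
  have long: "len p0 < len ps" if "ps \<in> Q" "n < length ps" for ps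
  proof -
    have "len p0 < c * n0" using n0 c_pos by (simp add: field_simps)
    also have "\<dots> \<le> c * n" using c_pos by (simp add: n_def)
    also have "\<dots> \<le> len ps" using that by (intro lower') (auto simp: Q_def n_def)
    finally show ?thesis .
  qed
  have "hd ps \<in> carrier G \<and> set ps \<subseteq> {z \<in> carrier G. wd \<one> z \<le> wd \<one> x + length ps}" if "ps \<in> Q" for ps
  proof -
    have ps: "edge_path G S ps" "ps \<noteq> []" "hd ps = x" using that by (auto simp: Q_def edge_path_def)
    have "wd \<one> (ps ! i) \<le> wd \<one> x + length ps" if "i < length ps" for i
    proof -
      have "wd (ps ! 0) (ps ! i) \<le> i - 0"
        using ps that by (intro wd_path_le[where n = i and g = "(!) ps"])
          (auto simp: edge_path_iff subset_iff)
      then show ?thesis using wd_triangle[of \<one> x "ps ! i"] ps that assms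
        by (simp add: hd_conv_nth edge_path_iff subset_iff)
    qed
    then show ?thesis using ps assms by (auto simp: edge_path_iff in_set_conv_nth)
  qed
  then have "A \<subseteq> {ps. set ps \<subseteq> {z \<in> carrier G. wd \<one> z \<le> wd \<one> x + max n (length p0)}
      \<and> length ps \<le> max n (length p0)}"
    unfolding A_def by fastforce
  then have finA: "finite A"
    using finite_lists_length_le[OF finite_word_ball] finite_subset by blast
  have "p0 \<in> A" using p0 by (simp add: A_def)
  then obtain q where q: "q \<in> A" "\<And>ps. ps \<in> A \<Longrightarrow> len q \<le> len ps"
    using arg_min_if_finite(1)[OF finA, of len] arg_min_least[OF finA, of _ len] by blast
  have "geod q"
    unfolding geod_def
  proof (intro conjI allI impI)
    show "edge_path G S q" using q by (simp add: A_def Q_def)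
    fix qs assume "edge_path G S qs \<and> hd qs = hd q \<and> last qs = last q"
    then obtain rs where rs: "rs \<in> Q" "len rs \<le> len qs"
      using loop_erasure[of qs] q by (auto simp: A_def Q_def)
    have "len q \<le> len rs"
    proof (cases "rs \<in> A")
      case False
      then have "n < length rs" using rs by (simp add: A_def)
      then show ?thesis using long[OF rs(1)] q(2)[OF \<open>p0 \<in> A\<close>] by simp
    qed (use q in auto)
    then show "len q \<le> len qs" using rs by simp
  qed
  then show thesis using that q by (auto simp: A_def Q_def)
qed

definition \<kappa> :: nat where "\<kappa> = (SOME k. C < c * real k)"

lemma kappa: "C < c * real \<kappa>" "0 < \<kappa>"
proof -
  obtain k :: nat where "C / c < k" using reals_Archimedean2 by blast
  then have "C < c * real k" using c_pos by (simp add: field_simps)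
  then show "C < c * real \<kappa>" unfolding \<kappa>_def by (rule someI)
  then show "0 < \<kappa>" using C_pos by (intro gr0I) auto
qed

text \<open>A word geodesic between the endpoints costs at most \<open>C * n\<close>, whereas a
  self-avoiding path with at least \<open>\<kappa> * n\<close> edges costs at least
  \<open>c * \<kappa> * n\<close>, which is more by the choice of \<open>\<kappa>\<close>.\<close>

lemma geod_length:
  assumes "geod ps" "distinct ps" "N \<le> n" "0 < n" "wd \<one> (hd ps) \<le> n" "wd (hd ps) (last ps) \<le> n"
  shows "length ps \<le> \<kappa> * n"
proof (rule ccontr)
  assume *: "\<not> length ps \<le> \<kappa> * n"
  have x: "hd ps \<in> carrier G" "last ps \<in> carrier G"
    using geod_carrier[OF assms(1)] geod_ne[OF assms(1)] by auto
  obtain qs where qs: "edge_path G S qs" "distinct qs" "hd qs = hd ps" "last qs = last ps"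
      "length qs = Suc (wd (hd ps) (last ps))"
    using ex_distinct_path[OF x] by blast
  have "len ps \<le> len qs" using assms(1) qs by (simp add: geod_def)
  also have "\<dots> \<le> C * n" using qs assms by (intro upper) auto
  also have "\<dots> < c * \<kappa> * n" using kappa assms by simp
  also have "\<dots> = c * real (\<kappa> * n)" by simp
  also have "\<dots> \<le> len ps"
  proof (rule lower')
    have "n \<le> \<kappa> * n" using kappa by simp
    then show "N \<le> \<kappa> * n" "wd \<one> (hd ps) \<le> \<kappa> * n" using assms by linarith+
  qed (use * assms geod_edge_path in auto)
  finally show False by simp
qed

text \<open>Bisecting a path with at most \<open>2^k\<close> edges costs \<open>\<delta>\<close> at each of the \<open>k\<close> stages; this is the
  exponential divergence of geodesics.\<close>

lemma gp_dyadic: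
  assumes "p \<in> carrier G" "\<And>i. a \<le> i \<Longrightarrow> i \<le> b \<Longrightarrow> v i \<in> carrier G \<and> E \<le> real (wd p (v i))"
    "\<And>i. a \<le> i \<Longrightarrow> i < b \<Longrightarrow> E \<le> gp p (v i) (v (Suc i))" "a \<le> b" "b - a \<le> 2 ^ k"
  shows "E - k * \<delta> \<le> gp p (v a) (v b)"
  using assms(2-)
proof (induction k arbitrary: a b)
  case 0
  then consider "b = a" | "b = Suc a" by force
  then show ?case
    using 0 by cases (auto simp: gp_self)
next
  case (Suc k)
  define m where "m = (a + b) div 2"
  have m: "a \<le> m" "m \<le> b" "m - a \<le> 2 ^ k" "b - m \<le> 2 ^ k" using Suc.prems by (auto simp: m_def)
  have "E - k * \<delta> \<le> gp p (v a) (v m)" using Suc.prems m by (intro Suc.IH) auto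
  moreover have "E - k * \<delta> \<le> gp p (v m) (v b)" using Suc.prems m by (intro Suc.IH) auto
  moreover have "min (gp p (v a) (v m)) (gp p (v m) (v b)) - \<delta> \<le> gp p (v a) (v b)"
    using assms Suc.prems m by (intro hyperbolic) auto
  ultimately show ?case by (simp add: algebra_simps)
qed

text \<open>With \<open>k\<close> the rounded-up binary logarithm of 12 \<kappa> D, the second
  inequality compares a logarithm with \<open>D\<close>. It contradicts the conclusion of
  \<open>detour\<close>.\<close>

lemma log_growth: "\<exists>M0. \<forall>D>M0. \<exists>k. 12 * \<kappa> * D \<le> 2 ^ k \<and> 1 / 2 + (real k + 2) * \<delta> < real D"
proof -
  \<comment> \<open>The shift excludes the degenerate coefficient 0 in the asymptotic comparison.
    The 3 below is the 2 of the claim plus 1 for rounding the logarithm up.\<close>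
  define d where "d = \<delta> + 1"
  define h where "h = 12 * real \<kappa>"
  have pos: "0 < d" "0 < h" using delta_nonneg kappa by (auto simp: d_def h_def)
  have "eventually (\<lambda>D::nat. 1 / 2 + (log 2 (h * real D) + 3) * d < real D) sequentially"
    using pos by real_asymp
  then obtain M where M: "\<And>D. M \<le> D \<Longrightarrow> 1 / 2 + (log 2 (h * real D) + 3) * d < real D"
    by (auto simp: eventually_sequentially)
  show ?thesis
  proof (rule exI[of _ M], intro allI impI)
    fix D assume D: "M < D"
    define k where "k = nat \<lceil>log 2 (h * D)\<rceil>"
    have "1 \<le> 12 * \<kappa> * D" using D kappa by (simp add: Suc_le_eq)
    then have "real 1 \<le> real (12 * \<kappa> * D)" by (simp only: of_nat_le_iff)
    then have hD: "1 \<le> h * D" by (simp add: h_def)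
    have "h * D = 2 powr (log 2 (h * D))" using hD by simp
    also have "\<dots> \<le> 2 powr real k" unfolding k_def by (intro powr_mono) linarith+
    finally have "h * D \<le> 2 ^ k" by (simp add: powr_realpow)
    then have "real (12 * \<kappa> * D) \<le> real (2 ^ k)" by (simp add: h_def)
    then have 1: "12 * \<kappa> * D \<le> 2 ^ k" by (simp only: of_nat_le_iff)
    have "0 \<le> log 2 (h * D)" using hD by simp
    then have "real k + 2 \<le> log 2 (h * D) + 3" unfolding k_def by linarith
    then have "(real k + 2) * \<delta> \<le> (log 2 (h * D) + 3) * d"
      using delta_nonneg by (intro mult_mono) (auto simp: d_def)
    then have "1 / 2 + (real k + 2) * \<delta> < real D" using M[of D] D by simp
    with 1 show "\<exists>k. 12 * \<kappa> * D \<le> 2 ^ k \<and> 1 / 2 + (real k + 2) * \<delta> < real D" by blast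
  qed
qed

section \<open>Morse lemma\<close>

text \<open>Two points of \<open>g\<close> at distance 4 D on either side of \<open>g i\<close> are
  joined to \<open>ps\<close> by crossings of length at most 2 D. The part of \<open>ps\<close> in
  between has O(D) edges and avoids the ball of radius \<open>D\<close> about \<open>g i\<close>, so
  by \<open>gp_dyadic\<close> its ends have Gromov product at least D - O(log D) there. The two
  points of \<open>g\<close>, however, lie on opposite sides of \<open>g i\<close> and have product
  0.\<close>

lemma detour:
  assumes ps: "geod ps" "distinct ps" and g: "wgeod g n" "g 0 = hd ps" "g n = last ps" "i \<le> n"
    and D: "N \<le> D" "0 < D" "wd \<one> (g i) \<le> 4 * D"
    and far: "\<And>w. w \<in> set ps \<Longrightarrow> D \<le> wd (g i) w"
    and near: "\<And>j. j \<le> n \<Longrightarrow> wd (g i) (g j) \<le> 4 * D \<Longrightarrow> \<exists>w\<in>set ps. wd (g j) w \<le> 2 * D"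
    and k: "12 * \<kappa> * D \<le> 2 ^ k"
  shows "real D \<le> 1 / 2 + (real k + 2) * \<delta>"
proof -
  define p where "p = g i"
  have gc: "g j \<in> carrier G" if "j \<le> n" for j using g that by (auto simp: wgeod_def)
  have pc: "p \<in> carrier G" using gc g by (simp add: p_def)
  have psc: "ps ! a \<in> carrier G" if "a < length ps" for a
    using geod_carrier[OF ps(1)] nth_mem[OF that] by blast
  have g_dist: "wd p (g j) = (if i \<le> j then j - i else i - j)" if "j \<le> n" for j
    using g that wd_sym[OF pc gc[OF that]] by (auto simp: p_def wgeod_def)
  \<comment> \<open>A crossing stays away from \<open>p\<close>, as it starts at distance 4 D and
    has length at most 2 D. An endpoint of \<open>g\<close> lies on \<open>ps\<close> and needs no
    crossing.\<close>
  have branch: "\<exists>a<length ps. wd (g j) (ps ! a) \<le> 2 * D \<and> real D \<le> gp p (g j) (ps ! a)"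
    if j: "j \<le> n" and "wd p (g j) = 4 * D \<or> g j \<in> set ps" for j
    using that(2)
  proof
    assume *: "wd p (g j) = 4 * D"
    then obtain w where w: "w \<in> set ps" "wd (g j) w \<le> 2 * D" using near[OF j] by (auto simp: p_def)
    then obtain a where a: "a < length ps" "w = ps ! a" by (auto simp: in_set_conv_nth)
    have "wd p (g j) \<le> wd p w + wd (g j) w"
      using wd_triangle[OF pc psc[OF a(1)] gc[OF j]] wd_sym[OF gc[OF j] psc[OF a(1)]] a by simp
    then have "real D \<le> gp p (g j) w" using * w by (simp add: gp_def)
    then show ?thesis using a w by blast
  next
    assume *: "g j \<in> set ps"
    then obtain a where a: "a < length ps" "g j = ps ! a" by (auto simp: in_set_conv_nth)
    have "real D \<le> gp p (g j) (g j)" using far[OF *] gc[OF j] by (simp add: gp_self p_def)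
    then show ?thesis using a gc[OF j] by (intro exI[of _ a]) auto
  qed
  have ends: "g 0 \<in> set ps" "g n \<in> set ps" using g geod_ne[OF ps(1)] by auto
  \<comment> \<open>Truncated subtraction and \<open>min\<close> stop at the endpoints of
    \<open>g\<close> when these are closer than 4 D.\<close>
  define j1 j2 where "j1 = i - 4 * D" and "j2 = min n (i + 4 * D)"
  have j: "j1 \<le> i" "i \<le> j2" "j2 \<le> n" "j1 \<le> n" using g by (auto simp: j1_def j2_def)
  have dist4: "wd p (g j1) \<le> 4 * D" "wd p (g j2) \<le> 4 * D"
    using g_dist[of j1] g_dist[of j2] j by (auto simp: j1_def j2_def min_def)
  have "wd p (g j1) = 4 * D \<or> g j1 \<in> set ps"
    using g_dist[of j1] j ends by (cases "4 * D \<le> i") (auto simp: j1_def)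
  then obtain a where a: "a < length ps" "wd (g j1) (ps ! a) \<le> 2 * D" "real D \<le> gp p (g j1) (ps ! a)"
    using branch j by blast
  have "wd p (g j2) = 4 * D \<or> g j2 \<in> set ps"
    using g_dist[of j2] j ends by (cases "i + 4 * D \<le> n") (auto simp: j2_def min_def)
  then obtain b where b: "b < length ps" "wd (g j2) (ps ! b) \<le> 2 * D" "real D \<le> gp p (g j2) (ps ! b)"
    using branch j by blast
  note cs = pc gc[OF j(4)] gc[OF j(3)] psc[OF a(1)] psc[OF b(1)] one_closed
  \<comment> \<open>\<open>ps\<close> may visit the two points in either order.\<close>
  define l r where "l = min a b" and "r = max a b"
  have lr: "l \<le> r" "r < length ps" using a b by (auto simp: l_def r_def)
  \<comment> \<open>4 D along \<open>g\<close> plus 2 D across. As \<open>p\<close> is within 4 D of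
    the identity, 12 D is an admissible scale in \<open>geod_length\<close> for the piece between
    the two points.\<close>
  have dist6: "wd p (ps ! a) \<le> 6 * D" "wd p (ps ! b) \<le> 6 * D"
    using wd_triangle[OF cs(1) cs(2) cs(4)] wd_triangle[OF cs(1) cs(3) cs(5)] a b dist4 by auto
  have "wd \<one> (ps ! a) \<le> 12 * D" "wd \<one> (ps ! b) \<le> 12 * D"
    using wd_triangle[OF cs(6) cs(1) cs(4)] wd_triangle[OF cs(6) cs(1) cs(5)] dist6 D by (auto simp: p_def)
  then have lD: "wd \<one> (ps ! l) \<le> 12 * D" by (simp add: l_def min_def)
  have "wd (ps ! a) (ps ! b) \<le> 12 * D" "wd (ps ! b) (ps ! a) \<le> 12 * D"
    using wd_triangle[OF cs(4) cs(1) cs(5)] wd_sym[OF cs(1) cs(4)] dist6 wd_sym[OF cs(4) cs(5)] by auto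
  then have lrD: "wd (ps ! l) (ps ! r) \<le> 12 * D" by (auto simp: l_def r_def min_def max_def)
  define qs where "qs = drop l (take (Suc r) ps)"
  have qs: "geod qs" "distinct qs" "hd qs = ps ! l" "last qs = ps ! r" "length qs = Suc (r - l)"
    using lr ps unfolding qs_def
    by (auto intro!: geod_drop geod_take simp: hd_drop_conv_nth last_conv_nth)
  have "length qs \<le> \<kappa> * (12 * D)" using qs D lD lrD by (intro geod_length) auto
  then have "r - l \<le> 2 ^ k" using qs k by (simp add: mult.assoc mult.left_commute)
  have adj: "edge (ps ! j) (ps ! Suc j)" if "Suc j < length ps" for j
    using geod_edge_path[OF ps(1)] that by (simp add: edge_path_iff)
  have farj: "D \<le> wd p (ps ! j)" if "j < length ps" for j using far that by (simp add: p_def)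
  \<comment> \<open>Adjacent vertices at distance at least \<open>D\<close> from \<open>p\<close>
    have product at least D - 1/2; this is the starting value of the bisection.\<close>
  have "real D - 1 / 2 - k * \<delta> \<le> gp p (ps ! l) (ps ! r)"
  proof (rule gp_dyadic[OF pc])
    fix j assume "l \<le> j" "j < r"
    then have j': "Suc j < length ps" "j < length ps" using lr by auto
    have "wd (ps ! j) (ps ! Suc j) \<le> 1" using edge_wd adj psc j' by auto
    then show "real D - 1 / 2 \<le> gp p (ps ! j) (ps ! Suc j)"
      using farj[OF j'(1)] farj[OF j'(2)] by (simp add: gp_def field_simps)
  next
    fix j assume "l \<le> j" "j \<le> r"
    then show "ps ! j \<in> carrier G \<and> real D - 1 / 2 \<le> real (wd p (ps ! j))"
      using psc[of j] farj[of j] lr by auto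
  qed (use \<open>r - l \<le> 2 ^ k\<close> lr in auto)
  moreover have "gp p (ps ! l) (ps ! r) = gp p (ps ! a) (ps ! b)"
    using gp_sym cs by (auto simp: l_def r_def min_def max_def)
  \<comment> \<open>Two more hyperbolic inequalities carry the bound from \<open>ps\<close> back to
    \<open>g\<close>; they are the 2 in \<open>(real k + 2) * \<delta>\<close>.\<close>
  moreover have "min (gp p (g j1) (ps ! a)) (gp p (ps ! a) (ps ! b)) - \<delta> \<le> gp p (g j1) (ps ! b)"
    using cs by (intro hyperbolic) auto
  moreover have "min (gp p (g j1) (ps ! b)) (gp p (ps ! b) (g j2)) - \<delta> \<le> gp p (g j1) (g j2)"
    using cs by (intro hyperbolic) auto
  moreover have "gp p (ps ! b) (g j2) = gp p (g j2) (ps ! b)" using gp_sym cs by simp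
  moreover have "gp p (g j1) (g j2) = 0"
  proof -
    have "wd (g j1) (g j2) = j2 - j1" using g j by (auto simp: wgeod_def)
    then show ?thesis using g_dist[of j1] g_dist[of j2] j by (auto simp: gp_def)
  qed
  moreover have "0 \<le> k * \<delta>" using delta_nonneg by simp
  moreover have "(real k + 2) * \<delta> = k * \<delta> + 2 * \<delta>" by (simp add: algebra_simps)
  ultimately show ?thesis using a(3) b(3) delta_nonneg by linarith
qed

text \<open>A Morse lemma with an error that grows with the distance to the base point, because the
  bounds on \<open>\<omega>\<close> are only available at scales comparable with that distance. The point to apply
  \<open>detour\<close> to maximizes the distance to the \<open>\<omega>\<close>-geodesic minus the permitted error.\<close>

lemma morse:
  "\<exists>M. \<forall>ps g n i. geod ps \<and> distinct ps \<and> wgeod g n \<and> g 0 = hd ps \<and> g n = last ps \<and> i \<le> n \<longrightarrow>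
     (\<exists>w\<in>set ps. 4 * wd (g i) w \<le> 4 * M + wd \<one> (g i))"
proof -
  obtain M1 where M1: "\<And>D. M1 < D \<Longrightarrow> \<exists>k. 12 * \<kappa> * D \<le> 2 ^ k \<and> 1 / 2 + (real k + 2) * \<delta> < real D"
    using log_growth by blast
  define M where "M = max M1 N"
  have "\<exists>w\<in>set ps. 4 * wd (g i) w \<le> 4 * M + wd \<one> (g i)"
    if ps: "geod ps" "distinct ps" and g: "wgeod g n" "g 0 = hd ps" "g n = last ps" and i: "i \<le> n"
    for ps g n i
  proof (rule ccontr)
    assume neg: "\<not> (\<exists>w\<in>set ps. 4 * wd (g i) w \<le> 4 * M + wd \<one> (g i))"
    define f where "f j = Min (wd (g j) ` set ps)" for j
    have ne: "set ps \<noteq> {}" using geod_ne ps by simp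
    have f_le: "f j \<le> wd (g j) w" if "w \<in> set ps" for j w using that by (simp add: f_def)
    have f_att: "\<exists>w\<in>set ps. wd (g j) w = f j" for j
      using Min_in[of "wd (g j) ` set ps"] ne unfolding f_def by fastforce
    define h where "h j = 4 * int (f j) - int (wd \<one> (g j))" for j
    define m where "m = arg_min_on (\<lambda>j. - h j) {..n}"
    have m: "m \<le> n" "\<And>j. j \<le> n \<Longrightarrow> h j \<le> h m"
      using arg_min_if_finite(1)[of "{..n}" "\<lambda>j. - h j"] arg_min_least[of "{..n}" _ "\<lambda>j. - h j"]
      unfolding m_def by auto
    define D where "D = f m"
    have "4 * M + wd \<one> (g i) < 4 * f i" using f_att[of i] neg by fastforce
    \<comment> \<open>The maximal value exceeds 4 M, so \<open>D\<close> is beyond both thresholds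
      in \<open>M\<close> and is at least a quarter of the distance from \<open>g m\<close> to the
      identity.\<close>
    then have "4 * int M < h m" using m(2)[OF i] by (simp add: h_def)
    then have D: "M < D" "wd \<one> (g m) \<le> 4 * D" by (auto simp: h_def D_def)
    obtain k where k: "12 * \<kappa> * D \<le> 2 ^ k" "1 / 2 + (real k + 2) * \<delta> < real D"
      using M1[of D] D by (auto simp: M_def)
    have gc: "g j \<in> carrier G" if "j \<le> n" for j using g that by (auto simp: wgeod_def)
    have "real D \<le> 1 / 2 + (real k + 2) * \<delta>"
    proof (rule detour[OF ps g m(1) _ _ D(2) _ _ k(1)])
      fix j assume j: "j \<le> n" "wd (g m) (g j) \<le> 4 * D"
      have "wd \<one> (g j) \<le> wd \<one> (g m) + wd (g m) (g j)" using gc m j by (intro wd_triangle) auto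
      \<comment> \<open>Maximality at \<open>m\<close>: since the distance to the identity grows by
        at most 4 D, \<open>f\<close> grows by at most \<open>D\<close>.\<close>
      moreover have "4 * int (f j) - int (wd \<one> (g j)) \<le> 4 * int D - int (wd \<one> (g m))"
        using m(2)[OF j(1)] by (simp add: h_def D_def)
      ultimately have "f j \<le> 2 * D" using j(2) by linarith
      then show "\<exists>w\<in>set ps. wd (g j) w \<le> 2 * D" using f_att[of j] by force
    qed (use D f_le in \<open>auto simp: M_def D_def\<close>)
    with k show False by simp
  qed
  then show ?thesis by blast
qed

text \<open>The point is the branch point of the comparison tripod: its distance \<open>i\<close>
  from \<open>x\<close> is the Gromov product of 1 and \<open>y\<close> based at \<open>x\<close>,
  rounded down. There |x| - i and |y| - (n - i) agree with (x|y) up to 1/2, so the products of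
  \<open>g i\<close> with \<open>x\<close> and \<open>y\<close> are about (|g i| + (x|y)) / 2, and
  one hyperbolic inequality bounds |g i|.\<close>

lemma geodesic_close_point:
  assumes "x \<in> carrier G" "y \<in> carrier G" "wgeod g (wd x y)" "g 0 = x" "g (wd x y) = y"
  obtains i where "i \<le> wd x y" "real (wd \<one> (g i)) \<le> gp \<one> x y + 1 / 2 + 2 * \<delta>"
proof -
  define n where "n = wd x y"
  define i where "i = (wd \<one> x + n - wd \<one> y) div 2"
  have tri: "wd \<one> y \<le> wd \<one> x + n" "wd \<one> x \<le> wd \<one> y + n"
    using wd_triangle[of \<one> x y] wd_triangle[of \<one> y x] wd_sym assms by (auto simp: n_def)
  then have i: "i \<le> n" "2 * i \<le> wd \<one> x + n - wd \<one> y" "wd \<one> x + n - wd \<one> y \<le> 2 * i + 1"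
    by (auto simp: i_def)
  have gc: "g i \<in> carrier G" using assms i by (auto simp: wgeod_def n_def)
  have di: "wd x (g i) = i" "wd (g i) y = n - i"
    using assms(3-5) i unfolding wgeod_def n_def by (metis diff_zero le0 le_refl)+
  have "min (gp \<one> x (g i)) (gp \<one> (g i) y) - \<delta> \<le> gp \<one> x y"
    using assms gc by (intro hyperbolic) auto
  moreover have "2 * real i \<le> real (wd \<one> x) + n - wd \<one> y" "real (wd \<one> x) + n - wd \<one> y \<le> 2 * real i + 1"
    using i tri by linarith+
  ultimately have "real (wd \<one> (g i)) \<le> gp \<one> x y + 1 / 2 + 2 * \<delta>"
    using i(1) unfolding gp_def di n_def[symmetric] by (simp add: of_nat_diff min_def field_simps split: if_splits)
  then show thesis using that i n_def by blast
qed

lemma geod_near_one: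
  "\<exists>M. \<forall>ps. geod ps \<and> distinct ps \<and> gp \<one> (hd ps) (last ps) \<le> B \<longrightarrow> (\<exists>w\<in>set ps. wd \<one> w \<le> M)"
proof -
  obtain M where M: "\<And>ps g n i. \<lbrakk>geod ps; distinct ps; wgeod g n; g 0 = hd ps; g n = last ps; i \<le> n\<rbrakk> \<Longrightarrow>
     (\<exists>w\<in>set ps. 4 * wd (g i) w \<le> 4 * M + wd \<one> (g i))"
    using morse by blast
  define A where "A = nat \<lceil>B + 1 / 2 + 2 * \<delta>\<rceil>"
  \<comment> \<open>A point of the word geodesic within \<open>A\<close> of the identity has Morse
    error at most M + A/4, and A + M + A/4 is at most 2 A + M.\<close>
  have "\<exists>w\<in>set ps. wd \<one> w \<le> 2 * A + M" if ps: "geod ps" "distinct ps" "gp \<one> (hd ps) (last ps) \<le> B" for ps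
  proof -
    have c: "hd ps \<in> carrier G" "last ps \<in> carrier G"
      using geod_carrier[OF ps(1)] geod_ne[OF ps(1)] by auto
    obtain g where g: "wgeod g (wd (hd ps) (last ps))" "g 0 = hd ps" "g (wd (hd ps) (last ps)) = last ps"
      using ex_wgeod[OF c] by blast
    obtain i where i: "i \<le> wd (hd ps) (last ps)"
        "real (wd \<one> (g i)) \<le> gp \<one> (hd ps) (last ps) + 1 / 2 + 2 * \<delta>"
      using geodesic_close_point[OF c g] by blast
    have A: "wd \<one> (g i) \<le> A" using i(2) ps(3) unfolding A_def by linarith
    obtain w where w: "w \<in> set ps" "4 * wd (g i) w \<le> 4 * M + wd \<one> (g i)" using M[OF ps(1,2) g i(1)] by blast
    have "wd \<one> w \<le> wd \<one> (g i) + wd (g i) w"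
      using g(1) i(1) w(1) geod_carrier[OF ps(1)] by (intro wd_triangle) (auto simp: wgeod_def)
    then show ?thesis using w A by (intro bexI[of _ w]) auto
  qed
  then show ?thesis by blast
qed

text \<open>If \<open>(ps\<^sub>t | last ps)\<close> were small, the part of \<open>ps\<close> after \<open>t\<close> would come back near the identity,
  which bounds the number of edges before that return.\<close>

lemma geod_escape:
  "\<exists>T. \<forall>ps t. geod ps \<and> distinct ps \<and> wd \<one> (hd ps) \<le> R \<and> T \<le> t \<and> t < length ps \<longrightarrow>
     B \<le> gp \<one> (ps ! t) (last ps)"
proof -
  obtain M where M: "\<And>ps. geod ps \<Longrightarrow> distinct ps \<Longrightarrow> gp \<one> (hd ps) (last ps) \<le> B \<Longrightarrow> (\<exists>w\<in>set ps. wd \<one> w \<le> M)"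
    using geod_near_one by blast
  \<comment> \<open>A scale that dominates \<open>N\<close>, the norm \<open>R\<close> of the start
    and the distance \<open>R + M\<close> from the start to the point of return; the 1 keeps it
    positive.\<close>
  define n where "n = N + R + M + 1"
  have "B \<le> gp \<one> (ps ! t) (last ps)"
    if ps: "geod ps" "distinct ps" "wd \<one> (hd ps) \<le> R" and t: "\<kappa> * n \<le> t" "t < length ps" for ps t
  proof (rule ccontr)
    assume "\<not> ?thesis"
    then have "gp \<one> (hd (drop t ps)) (last (drop t ps)) \<le> B" using t by (simp add: hd_drop_conv_nth)
    then obtain w where w: "w \<in> set (drop t ps)" "wd \<one> w \<le> M"
      using M[of "drop t ps"] geod_drop[OF ps(1) t(2)] ps by auto
    then obtain j where "j < length ps - t" "w = drop t ps ! j" by (auto simp: in_set_conv_nth)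
    then obtain s where s: "t \<le> s" "s < length ps" "w = ps ! s" using t by (auto intro: that[of "t + j"])
    define qs where "qs = take (Suc s) ps"
    have "last qs = w" using s by (simp add: qs_def take_Suc_conv_app_nth)
    then have qs: "geod qs" "distinct qs" "hd qs = hd ps" "last qs = w" "length qs = Suc s"
      using ps s geod_take by (auto simp: qs_def)
    have c: "hd ps \<in> carrier G" "w \<in> carrier G"
      using geod_carrier[OF ps(1)] geod_ne[OF ps(1)] s by auto
    have "wd (hd ps) w \<le> R + M"
      using wd_triangle[OF c(1) one_closed c(2)] wd_sym[OF one_closed c(1)] ps w by simp
    then have "length qs \<le> \<kappa> * n"
      using qs ps by (intro geod_length) (auto simp: n_def)
    then show False using qs s t by simp
  qed
  then show ?thesis by blast
qed

end

section \<open>Bi-infinite geodesics\<close>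

text \<open>Stage \<open>n\<close> of the diagonal argument stabilizes the coordinates n and -n
  together, so the stages are indexed by natural numbers although the sequences are
  bi-infinite.\<close>

lemma diagonal_int:
  fixes q :: "nat \<Rightarrow> int \<Rightarrow> 'c"
  assumes fin: "\<And>z. finite (range (\<lambda>i. q i z))"
  obtains d p where "strict_mono d" "\<And>z i. nat \<bar>z\<bar> < i \<Longrightarrow> q (d i) z = p z"
proof -
  define P where "P n s \<longleftrightarrow> (\<forall>i. q (s i) (int n) = q (s 0) (int n) \<and> q (s i) (- int n) = q (s 0) (- int n))"
    for n and s :: "nat \<Rightarrow> nat"
  interpret subseqs P
  proof
    fix n and s :: "nat \<Rightarrow> nat" assume "strict_mono s"
    define f where "f i = (q (s i) (int n), q (s i) (- int n))" for i
    have "finite (range f)"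
      by (rule finite_subset[of _ "range (\<lambda>i. q i (int n)) \<times> range (\<lambda>i. q i (- int n))"])
        (auto simp: f_def fin)
    then obtain a where "infinite {i. f i = f a}"
      using pigeonhole_infinite[of UNIV f] by auto
    then obtain r :: "nat \<Rightarrow> nat" where r: "strict_mono r" "\<And>i. r i \<in> {i. f i = f a}"
      using infinite_enumerate by blast
    have "f (r i) = f (r 0)" for i using r(2)[of i] r(2)[of 0] by simp
    then have "P n (s \<circ> r)" by (auto simp: P_def f_def)
    then show "\<exists>r. strict_mono r \<and> P n (s \<circ> r)" using r by blast
  qed
  have hold: "P n (diagseq \<circ> (+) (Suc n))" for n
  proof (rule diagseq_holds)
    fix r s :: "nat \<Rightarrow> nat" and n assume "P n s"
    then have "q (s i) (int n) = q (s 0) (int n)" "q (s i) (- int n) = q (s 0) (- int n)" for i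
      by (auto simp: P_def)
    then show "P n (s \<circ> r)" unfolding P_def comp_def by metis
  qed
  show thesis
  proof (rule that[of diagseq "\<lambda>z. q (diagseq (Suc (nat \<bar>z\<bar>))) z"])
    fix z :: int and i assume "nat \<bar>z\<bar> < i"
    then obtain j where "i = Suc (nat \<bar>z\<bar>) + j" using less_iff_Suc_add by auto
    moreover have "z = int (nat \<bar>z\<bar>) \<or> z = - int (nat \<bar>z\<bar>)" by auto
    ultimately show "q (diagseq i) z = q (diagseq (Suc (nat \<bar>z\<bar>))) z"
      using hold[of "nat \<bar>z\<bar>"] by (simp add: P_def) metis
  qed (rule subseq_diagseq)
qed

context regular_cayley_graph
begin

section \<open>Gromov boundary and directions\<close>

lemma gromov_close_iff:
  "gromov_close G S x y \<longleftrightarrow> (\<forall>B. \<exists>K. \<forall>i\<ge>K. \<forall>j\<ge>K. B \<le> gp \<one> (x i) (y j))"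
  unfolding gromov_close_def filterlim_at_top eventually_prod_sequentially prod.case
  by (rule all_cong1, rule ex_cong1) auto

lemma gromov_close_sym:
  assumes "range x \<subseteq> carrier G" "range y \<subseteq> carrier G" "gromov_close G S x y"
  shows "gromov_close G S y x"
proof -
  have "gp \<one> (y i) (x j) = gp \<one> (x j) (y i)" for i j using assms by (intro gp_sym) auto
  then show ?thesis using assms(3) unfolding gromov_close_iff by metis
qed

text \<open>Hyperbolicity makes closeness an equivalence: passing through \<open>y\<close> costs one
  \<delta>, which does not affect divergence.\<close>

lemma gromov_close_trans:
  assumes "range x \<subseteq> carrier G" "range y \<subseteq> carrier G" "range z \<subseteq> carrier G"
    "gromov_close G S x y" "gromov_close G S y z"
  shows "gromov_close G S x z"
  unfolding gromov_close_iff
proof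
  fix B
  obtain K where K: "\<And>i j. K \<le> i \<Longrightarrow> K \<le> j \<Longrightarrow> B + \<delta> \<le> gp \<one> (x i) (y j)"
    using assms(4) unfolding gromov_close_iff by meson
  obtain L where L: "\<And>i j. L \<le> i \<Longrightarrow> L \<le> j \<Longrightarrow> B + \<delta> \<le> gp \<one> (y i) (z j)"
    using assms(5) unfolding gromov_close_iff by meson
  have "B \<le> gp \<one> (x i) (z j)" if "max K L \<le> i" "max K L \<le> j" for i j
  proof -
    have "min (gp \<one> (x i) (y i)) (gp \<one> (y i) (z j)) - \<delta> \<le> gp \<one> (x i) (z j)"
      using assms by (intro hyperbolic) auto
    then show ?thesis using K[of i i] L[of i j] that by (auto simp: min_def split: if_splits)
  qed
  then show "\<exists>K. \<forall>i\<ge>K. \<forall>j\<ge>K. B \<le> gp \<one> (x i) (z j)" by blast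
qed

abbreviation boundary_rel :: "((nat \<Rightarrow> 'a) \<times> (nat \<Rightarrow> 'a)) set" where
  "boundary_rel \<equiv>
     {(x, y). x \<in> gromov_sequences G S \<and> y \<in> gromov_sequences G S \<and> gromov_close G S x y}"

lemma equiv_boundary_rel: "equiv (gromov_sequences G S) boundary_rel"
proof (rule equivI)
  show "refl_on (gromov_sequences G S) boundary_rel"
    by (auto simp: refl_on_def gromov_sequences_def)
  show "sym boundary_rel" using gromov_close_sym by (auto simp: sym_def gromov_sequences_def)
  show "trans boundary_rel"
    unfolding trans_def gromov_sequences_def using gromov_close_trans by blast
qed auto

lemma boundary_sequences:
  assumes "\<xi> \<in> gromov_boundary G S" "x \<in> \<xi>" shows "x \<in> gromov_sequences G S"
  using in_quotient_imp_subset[OF equiv_boundary_rel assms(1)[unfolded gromov_boundary_def]] assms(2)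
  by (rule subsetD)

lemma boundary_eqI:
  assumes "\<xi> \<in> gromov_boundary G S" "\<eta> \<in> gromov_boundary G S" "x \<in> \<xi>" "y \<in> \<eta>" "gromov_close G S x y"
  shows "\<xi> = \<eta>"
proof -
  have "(x, y) \<in> boundary_rel" using boundary_sequences assms by simp
  then show ?thesis
    using quotient_eqI[OF equiv_boundary_rel _ _ assms(3,4)] assms(1,2) unfolding gromov_boundary_def by simp
qed

lemma boundary_closed:
  assumes "\<xi> \<in> gromov_boundary G S" "x \<in> \<xi>" "range y \<subseteq> carrier G" "gromov_close G S y x"
  shows "y \<in> \<xi>"
proof -
  have x: "x \<in> gromov_sequences G S" using boundary_sequences assms by blast
  then have xc: "range x \<subseteq> carrier G" by (simp add: gromov_sequences_def)
  have xy: "gromov_close G S x y" using gromov_close_sym[OF assms(3) xc assms(4)] .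
  then have "y \<in> gromov_sequences G S"
    using gromov_close_trans[OF assms(3) xc assms(3,4)] assms(3) by (simp add: gromov_sequences_def)
  then have "(x, y) \<in> boundary_rel" using x xy by simp
  then show ?thesis using in_quotient_imp_closed[OF equiv_boundary_rel] assms
    unfolding gromov_boundary_def by blast
qed

text \<open>A subsequence of a convergent sequence stays close to it, so it cannot belong to another
  class.\<close>

lemma has_directionI:
  assumes "\<xi> \<in> gromov_boundary G S" "p \<in> \<xi>"
  shows "has_direction G S p \<xi>"
proof -
  have "\<eta> = \<xi>" if "\<eta> \<in> gromov_boundary G S" "strict_mono r" "p \<circ> r \<in> \<eta>" for \<eta> r
  proof -
    have "gromov_close G S p p" using boundary_sequences[OF assms] by (simp add: gromov_sequences_def)
    moreover have "i \<le> r i" for i using that(2) by (rule seq_suble)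
    ultimately have "gromov_close G S (p \<circ> r) p"
      unfolding gromov_close_iff comp_def by (meson le_trans)
    then show ?thesis using boundary_eqI that assms by blast
  qed
  moreover have "p \<circ> id \<in> \<xi>" "strict_mono (id :: nat \<Rightarrow> nat)" using assms by (auto simp: strict_mono_def)
  ultimately show ?thesis
    unfolding has_direction_def accumulation_points_def using assms by blast
qed

lemma boundary_tendsto:
  assumes "\<xi> \<in> gromov_boundary G S" "x \<in> \<xi>"
  obtains K where "\<And>i. K \<le> i \<Longrightarrow> n \<le> wd \<one> (x i)"
proof -
  have x: "gromov_close G S x x" "range x \<subseteq> carrier G"
    using boundary_sequences[OF assms] by (auto simp: gromov_sequences_def)
  obtain K where "\<And>i j. K \<le> i \<Longrightarrow> K \<le> j \<Longrightarrow> real n \<le> gp \<one> (x i) (x j)"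
    using x(1) unfolding gromov_close_iff by meson
  then have "n \<le> wd \<one> (x i)" if "K \<le> i" for i
    using that x gp_self[of "x i" \<one>] by (metis of_nat_le_iff range_subsetD)
  then show thesis using that by blast
qed

text \<open>Negating closeness yields a product below \<open>B\<close> only for some large indices
  \<open>a\<close>, \<open>b\<close>. Two hyperbolic inequalities, from \<open>a\<close> to
  \<open>i\<close> and from \<open>b\<close> to \<open>j\<close>, spread the bound to all large
  indices at the cost of 2 \<delta>.\<close>

lemma distinct_boundary_points:
  assumes "\<xi> \<in> gromov_boundary G S" "\<eta> \<in> gromov_boundary G S" "\<xi> \<noteq> \<eta>" "x \<in> \<xi>" "y \<in> \<eta>"
  obtains K B where "\<And>i j. K \<le> i \<Longrightarrow> K \<le> j \<Longrightarrow> gp \<one> (x i) (y j) \<le> B"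
proof -
  have x: "gromov_close G S x x" "range x \<subseteq> carrier G" and y: "gromov_close G S y y" "range y \<subseteq> carrier G"
    using boundary_sequences assms by (auto simp: gromov_sequences_def)
  have "\<not> gromov_close G S x y" using boundary_eqI assms by blast
  then obtain B where B: "\<And>K. \<exists>i\<ge>K. \<exists>j\<ge>K. gp \<one> (x i) (y j) < B"
    unfolding gromov_close_iff by (meson not_le)
  obtain K1 where K1: "\<And>i j. K1 \<le> i \<Longrightarrow> K1 \<le> j \<Longrightarrow> B + 2 * \<delta> \<le> gp \<one> (x i) (x j)"
    using x(1) unfolding gromov_close_iff by meson
  obtain K2 where K2: "\<And>i j. K2 \<le> i \<Longrightarrow> K2 \<le> j \<Longrightarrow> B + 2 * \<delta> \<le> gp \<one> (y i) (y j)"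
    using y(1) unfolding gromov_close_iff by meson
  define K where "K = max K1 K2"
  obtain a b where ab: "K \<le> a" "K \<le> b" "gp \<one> (x a) (y b) < B" using B[of K] by blast
  have "gp \<one> (x i) (y j) \<le> B + 2 * \<delta>" if "K \<le> i" "K \<le> j" for i j
  proof -
    have "min (gp \<one> (x a) (x i)) (gp \<one> (x i) (y j)) - \<delta> \<le> gp \<one> (x a) (y j)"
      "min (gp \<one> (x a) (y j)) (gp \<one> (y j) (y b)) - \<delta> \<le> gp \<one> (x a) (y b)"
      using x y by (auto intro!: hyperbolic)
    then show ?thesis using K1[of a i] K2[of j b] ab that delta_nonneg
      by (auto simp: K_def min_def split: if_splits)
  qed
  then show thesis using that by blast
qed

text \<open>The threshold of \<open>geod_escape\<close> is the same for all geodesics in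
  \<open>pieces\<close>, so (p n | y j) is large for every large n although j varies with n. As j
  may be taken large, one further \<delta> replaces \<open>y j\<close> by
  \<open>y i\<close>.\<close>

lemma direction_of_limit:
  assumes "\<xi> \<in> gromov_boundary G S" "y \<in> \<xi>" "range p \<subseteq> carrier G"
    and pieces: "\<And>n J. \<exists>j\<ge>J. \<exists>qs. geod qs \<and> distinct qs \<and> wd \<one> (hd qs) \<le> M \<and>
      n < length qs \<and> qs ! n = p n \<and> last qs = y j"
  shows "has_direction G S p \<xi>"
proof -
  have y: "gromov_close G S y y" "range y \<subseteq> carrier G"
    using boundary_sequences[OF assms(1,2)] by (auto simp: gromov_sequences_def)
  have "gromov_close G S p y"
    unfolding gromov_close_iff
  proof
    fix B
    obtain T where T: "\<And>ps t. \<lbrakk>geod ps; distinct ps; wd \<one> (hd ps) \<le> M; T \<le> t; t < length ps\<rbrakk> \<Longrightarrow>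
        B + \<delta> \<le> gp \<one> (ps ! t) (last ps)"
      using geod_escape[of M "B + \<delta>"] by blast
    obtain J where J: "\<And>i j. J \<le> i \<Longrightarrow> J \<le> j \<Longrightarrow> B + \<delta> \<le> gp \<one> (y i) (y j)"
      using y(1) unfolding gromov_close_iff by meson
    have "B \<le> gp \<one> (p n) (y i)" if "max T J \<le> n" "max T J \<le> i" for n i
    proof -
      obtain j qs where "J \<le> j" "geod qs" "distinct qs" "wd \<one> (hd qs) \<le> M" "n < length qs"
          "qs ! n = p n" "last qs = y j"
        using pieces[of J n] by blast
      then have "B + \<delta> \<le> gp \<one> (p n) (y j)" "B + \<delta> \<le> gp \<one> (y j) (y i)"
        using T[of qs n] J[of j i] that by auto
      moreover have "min (gp \<one> (p n) (y j)) (gp \<one> (y j) (y i)) - \<delta> \<le> gp \<one> (p n) (y i)"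
        using y assms by (intro hyperbolic) auto
      ultimately show ?thesis by (auto simp: min_def split: if_splits)
    qed
    then show "\<exists>K. \<forall>i\<ge>K. \<forall>j\<ge>K. B \<le> gp \<one> (p i) (y j)" by blast
  qed
  then show ?thesis using boundary_closed has_directionI assms by blast
qed

lemma ex_bi_infinite_geodesic:
  assumes \<xi>: "\<xi>\<^sub>1 \<in> gromov_boundary G S" "\<xi>\<^sub>2 \<in> gromov_boundary G S" "\<xi>\<^sub>1 \<noteq> \<xi>\<^sub>2"
  shows "\<exists>p. bi_infinite_geodesic G S \<omega> p \<and> joins G S p \<xi>\<^sub>1 \<xi>\<^sub>2"
proof -
  obtain x y where xy: "x \<in> \<xi>\<^sub>1" "y \<in> \<xi>\<^sub>2"
    using \<xi> in_quotient_imp_non_empty[OF equiv_boundary_rel] unfolding gromov_boundary_def by blast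
  have xc: "x i \<in> carrier G" and yc: "y i \<in> carrier G" for i
    using boundary_sequences[OF \<xi>(1) xy(1)] boundary_sequences[OF \<xi>(2) xy(2)]
    by (auto simp: gromov_sequences_def)
  obtain K B where BK: "\<And>i j. K \<le> i \<Longrightarrow> K \<le> j \<Longrightarrow> gp \<one> (x i) (y j) \<le> B"
    using distinct_boundary_points[OF \<xi> xy] by metis
  obtain M where M: "\<And>ps. geod ps \<Longrightarrow> distinct ps \<Longrightarrow> gp \<one> (hd ps) (last ps) \<le> B \<Longrightarrow>
      (\<exists>w\<in>set ps. wd \<one> w \<le> M)"
    using geod_near_one by blast
  have "\<exists>ps k. geod ps \<and> distinct ps \<and> hd ps = x (K + i) \<and> last ps = y (K + i) \<and> k < length ps \<and> wd \<one> (ps ! k) \<le> M"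
    for i
  proof -
    obtain ps where ps: "geod ps" "distinct ps" "hd ps = x (K + i)" "last ps = y (K + i)"
      using ex_geod[OF xc yc] by blast
    have "gp \<one> (hd ps) (last ps) \<le> B" using ps BK[of "K + i" "K + i"] by simp
    then obtain w where "w \<in> set ps" "wd \<one> w \<le> M" using M[OF ps(1,2)] by blast
    then obtain k where "k < length ps" "wd \<one> (ps ! k) \<le> M" by (auto simp: in_set_conv_nth)
    then show ?thesis using ps by blast
  qed
  then obtain ps k where
    ps: "\<And>i. geod (ps i)" "\<And>i. distinct (ps i)" "\<And>i. hd (ps i) = x (K + i)" "\<And>i. last (ps i) = y (K + i)"
    and k: "\<And>i. k i < length (ps i)" "\<And>i. wd \<one> (ps i ! k i) \<le> M"
    by metis
  define m where "m i = length (ps i)" for i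
  have psc: "ps i ! j \<in> carrier G" if "j < m i" for i j
    using geod_carrier[OF ps(1)] nth_mem that by (auto simp: m_def)
  have psd: "wd (ps i ! a) (ps i ! b) \<le> b - a" if "a \<le> b" "b < m i" for i a b
    using that psc geod_edge_path[OF ps(1)] that
    by (intro wd_path_le[where n = b and g = "(!) (ps i)"]) (auto simp: edge_path_iff m_def)
  have ne: "ps i \<noteq> []" for i using geod_ne ps by blast
  have nth_ends: "ps i ! 0 = x (K + i)" "ps i ! (m i - 1) = y (K + i)" for i
    using ps(3,4)[of i] ne by (simp_all add: hd_conv_nth last_conv_nth m_def)
  have x_le: "wd \<one> (x (K + i)) \<le> M + k i" for i
    using psd[of 0 "k i" i] k[of i] wd_triangle[of \<one> "ps i ! k i" "x (K + i)"] psc[of "k i" i]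
      wd_sym[of "x (K + i)" "ps i ! k i"] xc nth_ends[of i] by (auto simp: m_def)
  have y_le: "wd \<one> (y (K + i)) \<le> M + (m i - 1 - k i)" for i
  proof -
    have "k i \<le> m i - 1" "m i - 1 < m i" "k i < m i" using k(1)[of i] by (auto simp: m_def)
    then have "wd (ps i ! k i) (y (K + i)) \<le> m i - 1 - k i"
      using psd[of "k i" "m i - 1" i] nth_ends[of i] by simp
    then show ?thesis
      using k(2)[of i] wd_triangle[OF one_closed psc[OF \<open>k i < m i\<close>] yc, of "K + i"] by simp
  qed
  \<comment> \<open>The endpoints leave every ball while the vertex at index \<open>k i\<close>
    stays within \<open>M\<close> of the identity, so the path becomes long on both sides of
    it.\<close>
  have room: "\<exists>I. \<forall>i\<ge>I. n \<le> k i \<and> k i + n < m i" for n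
  proof -
    obtain I1 where I1: "\<And>i. I1 \<le> i \<Longrightarrow> M + n + 1 \<le> wd \<one> (x i)"
      using boundary_tendsto[OF \<xi>(1) xy(1), where n = "M + n + 1"] by metis
    obtain I2 where I2: "\<And>i. I2 \<le> i \<Longrightarrow> M + n + 1 \<le> wd \<one> (y i)"
      using boundary_tendsto[OF \<xi>(2) xy(2), where n = "M + n + 1"] by metis
    have "n \<le> k i \<and> k i + n < m i" if "max I1 I2 \<le> i" for i
      using I1[of "K + i"] I2[of "K + i"] x_le[of i] y_le[of i] that by auto
    then show ?thesis by blast
  qed
  \<comment> \<open>Re-indexing puts the vertex near the identity at 0. The padding by \<one> makes
    \<open>q i\<close> total; by \<open>room\<close> it eventually leaves every fixed
    window.\<close>
  define q where "q i z = (if 0 \<le> int (k i) + z \<and> int (k i) + z < int (m i)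
      then ps i ! nat (int (k i) + z) else \<one>)" for i z
  have q_at: "q i z = ps i ! j" if "int (k i) + z = int j" "j < m i" for i z j
    unfolding q_def that(1) using that(2) by simp
  have qc: "q i z \<in> carrier G" for i z using psc by (auto simp: q_def)
  have q_ball: "wd \<one> (q i z) \<le> M + nat \<bar>z\<bar>" for i z
  proof (cases "0 \<le> int (k i) + z \<and> int (k i) + z < int (m i)")
    case True
    define j where "j = nat (int (k i) + z)"
    have j: "j < m i" "q i z = ps i ! j" "k i < m i" using True k[of i] by (auto simp: j_def q_def m_def)
    have "wd (ps i ! k i) (ps i ! j) \<le> nat \<bar>z\<bar>"
    proof (cases "k i \<le> j")
      case True
      then show ?thesis using psd[of "k i" j i] j by (auto simp: j_def)
    next
      case False
      then show ?thesis using psd[of j "k i" i] j wd_sym[OF psc[OF j(1)] psc[OF j(3)]] by (auto simp: j_def)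
    qed
    then show ?thesis using wd_triangle[OF one_closed psc[OF j(3)] psc[OF j(1)]] k(2)[of i] j by simp
  qed (auto simp: q_def)
  have "finite (range (\<lambda>i. q i z))" for z
    by (rule finite_subset[OF _ finite_word_ball[of "M + nat \<bar>z\<bar>"]]) (use qc q_ball in auto)
  then obtain d p where d: "strict_mono d" and dp: "\<And>z i. nat \<bar>z\<bar> < i \<Longrightarrow> q (d i) z = p z"
    using diagonal_int by blast
  have d_ge: "i \<le> d i" for i using d by (rule seq_suble)
  have pc: "p z \<in> carrier G" for z
    using dp[of z "Suc (nat \<bar>z\<bar>)"] qc[of "d (Suc (nat \<bar>z\<bar>))" z] by simp
  \<comment> \<open>The freedom in \<open>J\<close> serves the directions, where the far endpoint
    must run along its sequence; a single stage suffices for the geodesic property.\<close>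
  have stage: "\<exists>i\<ge>J. (\<forall>z. \<bar>z\<bar> \<le> int n \<longrightarrow> q i z = p z) \<and> n \<le> k i \<and> k i + n < m i" for n J
  proof -
    obtain I where I: "\<And>i. I \<le> i \<Longrightarrow> n \<le> k i \<and> k i + n < m i" using room by blast
    define i where "i = Suc (max I (max n J))"
    have "I \<le> d i" "J \<le> d i" using d_ge[of i] by (auto simp: i_def)
    moreover have "q (d i) z = p z" if "\<bar>z\<bar> \<le> int n" for z using that by (intro dp) (auto simp: i_def)
    ultimately show ?thesis using I by blast
  qed
  have "fpp_geodesic G S \<omega> (map p [a..b])" if "a \<le> b" for a b
  proof -
    define n where "n = nat (max \<bar>a\<bar> \<bar>b\<bar>)"
    obtain i where i: "\<And>z. \<bar>z\<bar> \<le> int n \<Longrightarrow> q i z = p z" "n \<le> k i" "k i + n < m i"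
      using stage[of 0 n] by blast
    have n_ab: "- int n \<le> a" "b \<le> int n" unfolding n_def by auto
    define l where "l = nat (int (k i) + a)"
    define e where "e = nat (b - a)"
    have le: "int l = int (k i) + a" "int e = b - a" "l + e < m i"
      using n_ab i(2,3) that unfolding l_def e_def by linarith+
    have "b - a + 1 = int (Suc e)" using le(2) by simp
    then have length_ab: "nat (b - a + 1) = Suc e" by (simp only: nat_int)
    have room_e: "Suc e \<le> length (ps i) - l" using le(3) unfolding m_def by linarith
    \<comment> \<open>A window of the limit is a contiguous part of one \<open>ps i\<close>, so it
      is minimal without any passage to the limit of lengths.\<close>
    have "map p [a..b] = take (Suc e) (drop l (ps i))"
    proof (rule nth_equalityI)
      show "length (map p [a..b]) = length (take (Suc e) (drop l (ps i)))"
        using room_e by (simp add: length_ab)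
      fix j assume "j < length (map p [a..b])"
      then have j: "j \<le> e" by (simp add: length_ab)
      then have ab: "a \<le> a + int j" "a + int j \<le> b" using le(2) by linarith+
      then have "\<bar>a + int j\<bar> \<le> int n" using n_ab by linarith
      then have "p (a + int j) = q i (a + int j)" using i(1) by metis
      also have "\<dots> = ps i ! (l + j)"
        by (rule q_at) (use le(1,3) j in linarith)+
      finally show "map p [a..b] ! j = take (Suc e) (drop l (ps i)) ! j"
        using j ab room_e by (simp add: length_ab nth_upto)
    qed
    moreover have "geod (take (Suc e) (drop l (ps i)))"
      using room_e by (intro geod_take geod_drop ps(1)) linarith
    ultimately show ?thesis by (simp add: geod_fpp_geodesic)
  qed
  then have "bi_infinite_geodesic G S \<omega> p" by (simp add: bi_infinite_geodesic_def)
  moreover have "has_direction G S (\<lambda>n. p (int n)) \<xi>\<^sub>2"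
  proof (rule direction_of_limit[OF \<xi>(2) xy(2), where M = M])
    fix n J
    obtain i where i: "J \<le> i" "\<And>z. \<bar>z\<bar> \<le> int n \<Longrightarrow> q i z = p z" "n \<le> k i" "k i + n < m i"
      using stage[of J n] by blast
    define qs where "qs = drop (k i) (ps i)"
    have "geod qs \<and> distinct qs \<and> wd \<one> (hd qs) \<le> M \<and> n < length qs \<and> qs ! n = p (int n) \<and> last qs = y (K + i)"
      using i(2)[of "int n"] i k[of i] ps geod_drop[OF ps(1)] q_at[of i "int n" "k i + n"]
      by (auto simp: qs_def m_def hd_drop_conv_nth)
    then show "\<exists>j\<ge>J. \<exists>qs. geod qs \<and> distinct qs \<and> wd \<one> (hd qs) \<le> M \<and> n < length qs \<and>
        qs ! n = p (int n) \<and> last qs = y j"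
      using i(1) by (intro exI[of _ "K + i"]) auto
  qed (use pc in auto)
  moreover have "has_direction G S (\<lambda>n. p (- int n)) \<xi>\<^sub>1"
  proof (rule direction_of_limit[OF \<xi>(1) xy(1), where M = M])
    fix n J
    obtain i where i: "J \<le> i" "\<And>z. \<bar>z\<bar> \<le> int n \<Longrightarrow> q i z = p z" "n \<le> k i" "k i + n < m i"
      using stage[of J n] by blast
    define rs where "rs = take (Suc (k i)) (ps i)"
    have rs: "geod rs" "distinct rs" "length rs = Suc (k i)" "rs \<noteq> []" "hd rs = x (K + i)"
      "\<And>j. j \<le> k i \<Longrightarrow> rs ! j = ps i ! j"
      using ps k[of i] ne[of i] geod_take[OF ps(1)] by (auto simp: rs_def)
    \<comment> \<open>Reversed, the initial half starts near the identity and ends at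
      \<open>x (K + i)\<close>, as \<open>pieces\<close> requires.\<close>
    define qs where "qs = rev rs"
    have "last rs = ps i ! k i" using rs by (simp add: last_conv_nth)
    moreover have "qs ! n = p (- int n)"
      using i(2)[of "- int n"] i(3,4) rs q_at[of i "- int n" "k i - n"] by (simp add: qs_def rev_nth)
    ultimately have "geod qs \<and> distinct qs \<and> wd \<one> (hd qs) \<le> M \<and> n < length qs \<and> qs ! n = p (- int n) \<and>
        last qs = x (K + i)"
      using rs i geod_rev[OF rs(1)] k[of i] by (simp add: qs_def hd_rev last_rev)
    then show "\<exists>j\<ge>J. \<exists>qs. geod qs \<and> distinct qs \<and> wd \<one> (hd qs) \<le> M \<and> n < length qs \<and>
        qs ! n = p (- int n) \<and> last qs = x j"
      using i(1) by (intro exI[of _ "K + i"]) auto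
  qed (use pc in auto)
  ultimately show ?thesis unfolding joins_def by blast
qed

end

context cayley_graph
begin

section \<open>Almost sure bounds\<close>

text \<open>The radius of the ball of starting points is separate from the number of edges: the
  lower bound needs k = n, the upper bound all k \<le> n.\<close>

definition paths :: "nat \<Rightarrow> nat \<Rightarrow> 'a list set" where
  "paths n k = {ps. edge_path G S ps \<and> distinct ps \<and> wd \<one> (hd ps) \<le> n \<and> length ps = Suc k}"

text \<open>A path is encoded by a word that leads to its starting point, padded with \<open>\<one>\<close> to length \<open>n\<close>,
  followed by its steps.\<close>

lemma paths_subset:
  "paths n k \<subseteq> (\<lambda>ws. map (\<lambda>i. word_prod (take i ws)) [n..<Suc (n + k)]) `
     {ws. set ws \<subseteq> insert \<one> S \<and> length ws = n + k}"
proof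
  fix ps assume "ps \<in> paths n k"
  then have ps: "edge_path G S ps" "wd \<one> (hd ps) \<le> n" "length ps = Suc k" "ps \<noteq> []"
    by (auto simp: paths_def edge_path_def)
  have psc: "ps ! i \<in> carrier G" if "i \<le> k" for i
    using ps that nth_mem[of i ps] by (auto simp: edge_path_iff)
  have hd: "hd ps = ps ! 0" using ps by (simp add: hd_conv_nth)
  then obtain u where u: "set u \<subseteq> S" "length u = wlen (hd ps)" "word_prod u = hd ps"
    using wlen_attained[of "hd ps"] psc[of 0] by auto
  have "wlen (hd ps) \<le> n" using ps(2) hd psc[of 0] by (simp add: wd_def)
  define u' where "u' = u @ replicate (n - length u) \<one>"
  have uc: "set u \<subseteq> carrier G" using u gen_carrier by auto
  have rc: "set (replicate m \<one>) \<subseteq> carrier G \<and> word_prod (replicate m \<one>) = \<one>" for m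
    by (induction m) auto
  have "word_prod u' = hd ps"
    unfolding u'_def using word_prod_append[OF uc conjunct1[OF rc]] rc u(3) hd psc[of 0] by simp
  moreover have "set u' \<subseteq> insert \<one> S" using u by (auto simp: u'_def)
  moreover have "length u' = n" using u \<open>wlen (hd ps) \<le> n\<close> by (simp add: u'_def)
  ultimately have u': "word_prod u' = hd ps" "set u' \<subseteq> insert \<one> S" "length u' = n" by auto
  define v where "v = map (\<lambda>i. inv (ps ! i) \<otimes> ps ! Suc i) [0..<k]"
  have "inv (ps ! i) \<otimes> ps ! Suc i \<in> S" if "i < k" for i
    using ps(1,3) that edge_iff[OF psc[of i] psc[of "Suc i"]] by (simp add: edge_path_iff)
  then have v: "set v \<subseteq> S" "length v = k" by (auto simp: v_def)
  have vc: "set v \<subseteq> carrier G" using v gen_carrier by auto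
  have uc': "set u' \<subseteq> carrier G" using u' gen_carrier by auto
  have "word_prod (u' @ take i v) = ps ! i" if "i \<le> k" for i
    using that
  proof (induction i)
    case 0
    then show ?case using u' hd by simp
  next
    case (Suc i)
    have vi: "v ! i = inv (ps ! i) \<otimes> ps ! Suc i" "v ! i \<in> carrier G"
      using Suc.prems psc[of i] psc[of "Suc i"] by (auto simp: v_def)
    have "u' @ take (Suc i) v = (u' @ take i v) @ [v ! i]"
      using Suc.prems v by (simp add: take_Suc_conv_app_nth)
    also have "word_prod \<dots> = word_prod (u' @ take i v) \<otimes> word_prod [v ! i]"
      using uc' vc vi set_take_subset[of i v] by (intro word_prod_append) auto
    also have "\<dots> = ps ! i \<otimes> v ! i" using Suc vi by simp
    also have "\<dots> = ps ! Suc i"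
      unfolding vi(1) using Suc.prems psc[of i] psc[of "Suc i"] by (simp add: mult_inv_cancel)
    finally show ?case .
  qed
  then have "ps = map (\<lambda>i. word_prod (take i (u' @ v))) [n..<Suc (n + k)]"
    using u'(3) ps(3) by (intro nth_equalityI) (auto simp del: upt_Suc)
  moreover have "u' @ v \<in> {ws. set ws \<subseteq> insert \<one> S \<and> length ws = n + k}"
    using u' v by auto
  ultimately show "ps \<in> (\<lambda>ws. map (\<lambda>i. word_prod (take i ws)) [n..<Suc (n + k)]) `
     {ws. set ws \<subseteq> insert \<one> S \<and> length ws = n + k}" by blast
qed

lemma finite_paths: "finite (paths n k)"
  by (rule finite_surj[OF finite_lists_length_eq paths_subset]) (simp add: finite_gen)

lemma card_paths: "card (paths n k) \<le> Suc (card S) ^ (n + k)"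
proof -
  have "card (paths n k) \<le> card {ws. set ws \<subseteq> insert \<one> S \<and> length ws = n + k}"
    by (rule surj_card_le[OF finite_lists_length_eq paths_subset]) (simp add: finite_gen)
  also have "\<dots> = card (insert \<one> S) ^ (n + k)"
    by (rule card_lists_length_eq) (simp add: finite_gen)
  also have "\<dots> \<le> Suc (card S) ^ (n + k)"
    by (intro power_mono) (auto simp: card_insert_if finite_gen)
  finally show ?thesis .
qed

definition path_edges :: "'a list \<Rightarrow> 'a set set" where
  "path_edges ps = (\<lambda>i. {ps ! i, ps ! Suc i}) ` {..<length ps - 1}"

text \<open>Distinct vertices force distinct edges, so the length is a sum over a set of
  \<open>k\<close> coordinates, which are independent under the product measure.\<close>

lemma path_edges:
  assumes "ps \<in> paths n k"
  shows "finite (path_edges ps)" "path_edges ps \<subseteq> cayley_edges G S" "card (path_edges ps) = k"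
    "fpp_length \<omega> ps = (\<Sum>e\<in>path_edges ps. \<omega> e)"
proof -
  have ps: "edge_path G S ps" "distinct ps" "length ps = Suc k" using assms by (auto simp: paths_def)
  have inj: "inj_on (\<lambda>i. {ps ! i, ps ! Suc i}) {..<length ps - 1}"
    using ps(2) by (auto simp: inj_on_def doubleton_eq_iff nth_eq_iff_index_eq)
  show "finite (path_edges ps)" by (simp add: path_edges_def)
  show "path_edges ps \<subseteq> cayley_edges G S" using ps(1) by (auto simp: path_edges_def edge_path_iff)
  show "card (path_edges ps) = k" unfolding path_edges_def using card_image[OF inj] ps by simp
  show "fpp_length \<omega> ps = (\<Sum>e\<in>path_edges ps. \<omega> e)"
    unfolding path_edges_def fpp_length_def using sum.reindex[OF inj, of \<omega>] by (simp add: comp_def)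
qed

end

text \<open>Restriction of the coordinates to \<open>J\<close> pushes \<open>PiM I M\<close> forward
  to \<open>PiM J M\<close>, where the formula for finite products applies.\<close>

lemma (in product_prob_space) nn_integral_PiM_prod:
  assumes "finite J" "J \<subseteq> I" "\<And>i. i \<in> J \<Longrightarrow> f i \<in> borel_measurable (M i)"
  shows "(\<integral>\<^sup>+\<omega>. (\<Prod>i\<in>J. f i (\<omega> i)) \<partial>PiM I M) = (\<Prod>i\<in>J. \<integral>\<^sup>+x. f i x \<partial>M i)"
proof -
  have meas: "(\<lambda>\<omega>. \<Prod>i\<in>J. f i (\<omega> i)) \<in> borel_measurable (PiM J M)"
    using measurable_compose[OF measurable_component_singleton[of _ J M] assms(3)]
    by (intro borel_measurable_prod_ennreal) auto
  have "(\<integral>\<^sup>+\<omega>. (\<Prod>i\<in>J. f i (\<omega> i)) \<partial>PiM J M)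
      = (\<integral>\<^sup>+\<omega>. (\<Prod>i\<in>J. f i (restrict \<omega> J i)) \<partial>PiM I M)"
    using meas assms(2)
    by (subst distr_PiM_restrict_finite[OF assms(1,2), symmetric], subst nn_integral_distr)
      (auto intro: measurable_restrict_subset)
  also have "\<dots> = (\<integral>\<^sup>+\<omega>. (\<Prod>i\<in>J. f i (\<omega> i)) \<partial>PiM I M)"
    by (intro nn_integral_cong prod.cong) auto
  finally show ?thesis using product_nn_integral_prod[OF assms(1,3)] by simp
qed

text \<open>Markov's inequality for the exponential of \<open>s\<close> times the sum, whose
  expectation factorizes. A negative \<open>s\<close> controls small sums, a positive one large
  sums.\<close>

lemma chernoff_PiM:
  fixes M :: "real measure" and s b K :: real
  assumes "prob_space M" and id: "(\<lambda>x. x) \<in> borel_measurable M" and J: "finite J" "J \<subseteq> I"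
    and K: "0 \<le> K" "(\<integral>\<^sup>+x. ennreal (exp (s * x)) \<partial>M) \<le> ennreal K"
  shows "{\<omega> \<in> space (PiM I (\<lambda>_. M)). b \<le> s * (\<Sum>i\<in>J. \<omega> i)} \<in> sets (PiM I (\<lambda>_. M))"
    and "measure (PiM I (\<lambda>_. M)) {\<omega> \<in> space (PiM I (\<lambda>_. M)). b \<le> s * (\<Sum>i\<in>J. \<omega> i)}
      \<le> exp (- b) * K ^ card J"
proof -
  interpret prob_space M by fact
  interpret P: product_prob_space "\<lambda>_. M" I
    by (simp add: product_prob_space_def product_prob_space_axioms_def product_sigma_finite_def
        prob_space_axioms prob_space_imp_sigma_finite)
  let ?P = "PiM I (\<lambda>_. M)" and ?A = "{\<omega> \<in> space (PiM I (\<lambda>_. M)). b \<le> s * (\<Sum>i\<in>J. \<omega> i)}"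
  have comp: "(\<lambda>\<omega>. \<omega> i) \<in> borel_measurable ?P" if "i \<in> J" for i
    using J that measurable_compose[OF measurable_component_singleton[of i I "\<lambda>_. M"] id] by auto
  then have "(\<lambda>\<omega>. s * (\<Sum>i\<in>J. \<omega> i)) \<in> borel_measurable ?P"
    by (intro borel_measurable_times borel_measurable_sum) auto
  then show A: "?A \<in> sets ?P" by measurable
  have fm: "(\<lambda>x. ennreal (exp (s * x))) \<in> borel_measurable M"
    using id by measurable
  have "emeasure ?P ?A = (\<integral>\<^sup>+\<omega>. indicator ?A \<omega> \<partial>?P)" using A by simp
  also have "\<dots> \<le> (\<integral>\<^sup>+\<omega>. ennreal (exp (- b)) * (\<Prod>i\<in>J. ennreal (exp (s * \<omega> i))) \<partial>?P)"
  proof (rule nn_integral_mono)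
    fix \<omega>
    have "(\<Prod>i\<in>J. ennreal (exp (s * \<omega> i))) = ennreal (exp (s * (\<Sum>i\<in>J. \<omega> i)))"
      using J by (simp add: prod_ennreal exp_sum sum_distrib_left)
    then have "ennreal (exp (- b)) * (\<Prod>i\<in>J. ennreal (exp (s * \<omega> i)))
        = ennreal (exp (s * (\<Sum>i\<in>J. \<omega> i) - b))"
      by (simp add: ennreal_mult[symmetric] exp_add[symmetric])
    then show "indicator ?A \<omega> \<le> ennreal (exp (- b)) * (\<Prod>i\<in>J. ennreal (exp (s * \<omega> i)))"
      by (auto simp: indicator_def)
  qed
  also have "\<dots> = ennreal (exp (- b)) * (\<integral>\<^sup>+\<omega>. (\<Prod>i\<in>J. ennreal (exp (s * \<omega> i))) \<partial>?P)"
    using comp by (intro nn_integral_cmult borel_measurable_prod_ennreal) measurable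
  also have "\<dots> = ennreal (exp (- b)) * (\<integral>\<^sup>+x. ennreal (exp (s * x)) \<partial>M) ^ card J"
    using fm by (subst P.nn_integral_PiM_prod[OF J]) auto
  also have "\<dots> \<le> ennreal (exp (- b)) * ennreal K ^ card J"
    using K by (intro mult_left_mono power_mono) auto
  also have "\<dots> = ennreal (exp (- b) * K ^ card J)"
    using K by (simp add: ennreal_mult ennreal_power)
  finally show "measure ?P ?A \<le> exp (- b) * K ^ card J"
    using K by (simp add: measure_def enn2real_leI)
qed

text \<open>As t grows, exp (- t x) tends to 0 for every x > 0, hence almost everywhere; dominated
  convergence with majorant 1 applies.\<close>

lemma small_laplace_transform:
  fixes M :: "real measure" and \<epsilon> :: real
  assumes "prob_space M" and sp: "space M = {0..}" and id: "(\<lambda>x. x) \<in> borel_measurable M"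
    and atom: "{0} \<in> sets M" "emeasure M {0} = 0" and "0 < \<epsilon>"
  shows "\<exists>t>0. (\<integral>\<^sup>+x. ennreal (exp (- t * x)) \<partial>M) \<le> ennreal \<epsilon>"
proof -
  interpret prob_space M by fact
  have "(\<lambda>n. \<integral>\<^sup>+x. ennreal (exp (- real n * x)) \<partial>M) \<longlonglongrightarrow> (\<integral>\<^sup>+x. 0 \<partial>M)"
  proof (rule nn_integral_dominated_convergence[where w = "\<lambda>_. 1"])
    have "{0} \<in> null_sets M" using atom by (auto simp: null_sets_def)
    then have "AE x in M. x \<notin> {0}" by (rule AE_not_in)
    then show "AE x in M. (\<lambda>n. ennreal (exp (- real n * x))) \<longlonglongrightarrow> 0"
    proof (rule AE_mp[OF _ AE_I2], intro impI)
      fix x assume "x \<in> space M" "x \<notin> {0}"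
      then have "0 < x" using sp by auto
      then have "(\<lambda>n. exp (- real n * x)) \<longlonglongrightarrow> 0" by real_asymp
      then show "(\<lambda>n. ennreal (exp (- real n * x))) \<longlonglongrightarrow> 0"
        using tendsto_ennrealI by fastforce
    qed
    show "AE x in M. ennreal (exp (- real n * x)) \<le> 1" for n
      using sp by (intro AE_I2) auto
    show "(\<integral>\<^sup>+x. 1 \<partial>M) < \<infinity>" by (simp add: emeasure_space_1)
  qed (use id in measurable)
  then have "(\<lambda>n. \<integral>\<^sup>+x. ennreal (exp (- real n * x)) \<partial>M) \<longlonglongrightarrow> 0" by simp
  moreover have "0 < ennreal \<epsilon>" using assms by simp
  ultimately have "eventually (\<lambda>n. (\<integral>\<^sup>+x. ennreal (exp (- real n * x)) \<partial>M) < ennreal \<epsilon>) sequentially"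
    by (rule order_tendstoD(2))
  then obtain n0 where "\<And>n. n0 \<le> n \<Longrightarrow> (\<integral>\<^sup>+x. ennreal (exp (- real n * x)) \<partial>M) < ennreal \<epsilon>"
    by (auto simp: eventually_sequentially)
  from this[of "Suc n0"] show ?thesis by (intro exI[of _ "real (Suc n0)"]) auto
qed

context cayley_graph
begin

lemma AE_path_bounds:
  fixes \<rho> :: "real measure" and a :: real
  assumes "prob_space \<rho>" and sp: "space \<rho> = {0..}" and id: "(\<lambda>x. x) \<in> borel_measurable \<rho>"
    and atom: "{0} \<in> sets \<rho>" "emeasure \<rho> {0} = 0"
    and a: "0 < a" "(\<integral>\<^sup>+x. ennreal (exp (a * x)) \<partial>\<rho>) < \<infinity>"
  shows "\<exists>c>0. \<exists>C>0. AE \<omega> in fpp_measure G S \<rho>. \<exists>N. \<forall>n\<ge>N.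
    (\<forall>ps\<in>paths n n. c * n \<le> fpp_length \<omega> ps) \<and>
    (\<forall>k\<le>n. \<forall>ps\<in>paths n k. fpp_length \<omega> ps \<le> C * n)"
proof -
  define M where "M = PiM (cayley_edges G S) (\<lambda>_. \<rho>)"
  interpret M: prob_space M unfolding M_def by (rule prob_space_PiM) (rule assms)
  define D where "D = real (Suc (card S))"
  have D: "1 \<le> D" by (simp add: D_def)
  \<comment> \<open>Makes \<open>D\<^sup>2 * (exp 1 * \<epsilon>)\<close> equal to 1/2: there are at
    most D^(2 n) paths, each too short with probability at most (e \<epsilon>)^n.\<close>
  define \<epsilon> where "\<epsilon> = exp (- 1) / (2 * D\<^sup>2)"
  have \<epsilon>: "0 < \<epsilon>" using D by (simp add: \<epsilon>_def)
  obtain t where t: "0 < t" "(\<integral>\<^sup>+x. ennreal (exp (- t * x)) \<partial>\<rho>) \<le> ennreal \<epsilon>"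
    using small_laplace_transform[OF assms(1) sp id atom \<epsilon>] by blast
  \<comment> \<open>The maximum with 1 makes the powers of \<open>m\<close> monotone, so
    \<open>m ^ n\<close> serves all k \<le> n.\<close>
  define m where "m = max 1 (enn2real (\<integral>\<^sup>+x. ennreal (exp (a * x)) \<partial>\<rho>))"
  have m: "1 \<le> m" "(\<integral>\<^sup>+x. ennreal (exp (a * x)) \<partial>\<rho>) \<le> ennreal m"
  proof -
    have "(\<integral>\<^sup>+x. ennreal (exp (a * x)) \<partial>\<rho>) = ennreal (enn2real (\<integral>\<^sup>+x. ennreal (exp (a * x)) \<partial>\<rho>))"
      using a by (simp add: less_top)
    also have "\<dots> \<le> ennreal m" by (intro ennreal_leI) (simp add: m_def)
    finally show "(\<integral>\<^sup>+x. ennreal (exp (a * x)) \<partial>\<rho>) \<le> ennreal m" .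
  qed (simp add: m_def)
  have D2: "1 \<le> D\<^sup>2" using D by simp
  have "1 * 1 \<le> D\<^sup>2 * m" using D2 m by (intro mult_mono) auto
  then have Dm: "1 < 4 * D\<^sup>2 * m" by simp
  \<comment> \<open>Makes \<open>D\<^sup>2 * (exp (- (a * C)) * m)\<close> equal to 1/4. The n + 1
    possible numbers of edges cost at most 2^n, which leaves (1/2)^n.\<close>
  define C where "C = ln (4 * D\<^sup>2 * m) / a"
  have C: "0 < C" unfolding C_def using Dm a(1) by (intro divide_pos_pos ln_gt_zero)
  have expC: "exp (- (a * C)) = 1 / (4 * D\<^sup>2 * m)"
  proof -
    have "a * C = ln (4 * D\<^sup>2 * m)" using a(1) by (simp add: C_def)
    moreover have "exp (ln (4 * D\<^sup>2 * m)) = 4 * D\<^sup>2 * m" using Dm by (intro exp_ln) linarith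
    ultimately show ?thesis by (simp only: exp_minus inverse_eq_divide)
  qed
  \<comment> \<open>The event that t times the length is at most n, with signs adapted to
    \<open>s = - t\<close> in \<open>chernoff_PiM\<close>; its complement gives c = 1/t.\<close>
  define Lo where "Lo n ps = {\<omega> \<in> space M. - real n \<le> - t * (\<Sum>e\<in>path_edges ps. \<omega> e)}" for n ps
  define Hi where "Hi n ps = {\<omega> \<in> space M. a * C * real n \<le> a * (\<Sum>e\<in>path_edges ps. \<omega> e)}" for n ps
  have Lo: "Lo n ps \<in> sets M" "measure M (Lo n ps) \<le> exp (real n) * \<epsilon> ^ k" if "ps \<in> paths n k" for n ps k
    using chernoff_PiM[OF assms(1) id path_edges(1,2)[OF that], of \<epsilon> "- t" "- real n"] t \<epsilon> path_edges(3)[OF that]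
    by (auto simp: Lo_def M_def)
  have Hi: "Hi n ps \<in> sets M" "measure M (Hi n ps) \<le> exp (- (a * C * real n)) * m ^ k" if "ps \<in> paths n k" for n ps k
    using chernoff_PiM[OF assms(1) id path_edges(1,2)[OF that], of m a "a * C * real n"] m path_edges(3)[OF that]
    by (auto simp: Hi_def M_def)
  define A where "A n = (\<Union>ps\<in>paths n n. Lo n ps) \<union> (\<Union>k\<in>{..n}. \<Union>ps\<in>paths n k. Hi n ps)" for n
  have sets: "(\<Union>ps\<in>paths n n. Lo n ps) \<in> sets M" "(\<Union>ps\<in>paths n k. Hi n ps) \<in> sets M"
    "(\<Union>k\<in>{..n}. \<Union>ps\<in>paths n k. Hi n ps) \<in> sets M" for n k
    using finite_paths Lo Hi by (auto intro!: sets.finite_UN)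
  have A: "A n \<in> sets M" for n unfolding A_def using sets by auto
  have card: "real (card (paths n k)) \<le> (D\<^sup>2) ^ n" if "k \<le> n" for n k
  proof -
    have "real (card (paths n k)) \<le> real (Suc (card S) ^ (n + k))" using card_paths of_nat_le_iff by blast
    also have "\<dots> = D ^ (n + k)" by (simp add: D_def)
    also have "\<dots> \<le> D ^ (2 * n)" using D that by (intro power_increasing) auto
    finally show ?thesis by (simp add: power_mult)
  qed
  have lo: "measure M (\<Union>ps\<in>paths n n. Lo n ps) \<le> (1 / 2) ^ n" for n
  proof -
    have "measure M (\<Union>ps\<in>paths n n. Lo n ps) \<le> (\<Sum>ps\<in>paths n n. measure M (Lo n ps))"
      using finite_paths Lo by (intro M.finite_measure_subadditive_finite) auto
    also have "\<dots> \<le> real (card (paths n n)) * (exp (real n) * \<epsilon> ^ n)"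
      using Lo by (intro sum_bounded_above) auto
    also have "\<dots> \<le> (D\<^sup>2) ^ n * (exp 1 ^ n * \<epsilon> ^ n)"
      using card[of n n] \<epsilon> by (intro mult_mono) (auto simp: exp_of_nat_mult[symmetric])
    also have "\<dots> = (D\<^sup>2 * (exp 1 * \<epsilon>)) ^ n" by (simp add: power_mult_distrib)
    also have "D\<^sup>2 * (exp 1 * \<epsilon>) = 1 / 2" using D by (simp add: \<epsilon>_def exp_minus field_simps)
    finally show ?thesis .
  qed
  have hi: "measure M (\<Union>k\<in>{..n}. \<Union>ps\<in>paths n k. Hi n ps) \<le> (1 / 2) ^ n" for n
  proof -
    define b where "b = exp (- (a * C)) ^ n * m ^ n"
    have Hi_b: "measure M (Hi n ps) \<le> b" if "k \<le> n" "ps \<in> paths n k" for k ps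
    proof -
      have "exp (- (a * C * real n)) = exp (- (a * C)) ^ n"
        by (simp add: exp_of_nat_mult[symmetric] mult.commute)
      moreover have "m ^ k \<le> m ^ n" using m(1) that(1) by (rule power_increasing[rotated])
      ultimately have "exp (- (a * C * real n)) * m ^ k \<le> b"
        unfolding b_def by (metis exp_ge_zero mult_left_mono)
      then show ?thesis using Hi(2)[OF that(2)] by linarith
    qed
    have b0: "0 \<le> b" using m by (simp add: b_def)
    have "measure M (\<Union>k\<in>{..n}. \<Union>ps\<in>paths n k. Hi n ps)
        \<le> (\<Sum>k\<in>{..n}. measure M (\<Union>ps\<in>paths n k. Hi n ps))"
      using sets by (intro M.finite_measure_subadditive_finite) auto
    also have "\<dots> \<le> (\<Sum>k\<in>{..n}. (D\<^sup>2) ^ n * b)"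
    proof (rule sum_mono)
      fix k assume k: "k \<in> {..n}"
      have "measure M (\<Union>ps\<in>paths n k. Hi n ps) \<le> (\<Sum>ps\<in>paths n k. measure M (Hi n ps))"
        using finite_paths Hi by (intro M.finite_measure_subadditive_finite) auto
      also have "\<dots> \<le> real (card (paths n k)) * b"
        using Hi_b k by (intro sum_bounded_above) auto
      also have "\<dots> \<le> (D\<^sup>2) ^ n * b" using card k b0 by (intro mult_right_mono) auto
      finally show "measure M (\<Union>ps\<in>paths n k. Hi n ps) \<le> (D\<^sup>2) ^ n * b" .
    qed
    also have "\<dots> = real (Suc n) * (D\<^sup>2 * (exp (- (a * C)) * m)) ^ n"
      by (simp add: b_def power_mult_distrib)
    also have "D\<^sup>2 * (exp (- (a * C)) * m) = 1 / 4"
    proof -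
      have "D \<noteq> 0" "m \<noteq> 0" using D m by auto
      then show ?thesis unfolding expC by simp
    qed
    also have "real (Suc n) * (1 / 4) ^ n \<le> 2 ^ n * (1 / 4) ^ n"
    proof (rule mult_right_mono)
      have "Suc n \<le> 2 ^ n" by (induction n) auto
      then have "real (Suc n) \<le> real (2 ^ n)" by (simp only: of_nat_le_iff)
      then show "real (Suc n) \<le> 2 ^ n" by simp
    qed simp
    also have "\<dots> = (1 / 2) ^ n" by (simp add: power_mult_distrib[symmetric])
    finally show ?thesis .
  qed
  have mA: "measure M (A n) \<le> 2 * (1 / 2) ^ n" for n
  proof -
    have "measure M (A n) \<le> measure M (\<Union>ps\<in>paths n n. Lo n ps)
        + measure M (\<Union>k\<in>{..n}. \<Union>ps\<in>paths n k. Hi n ps)"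
      unfolding A_def using sets by (intro measure_Un_le) auto
    then show ?thesis using lo[of n] hi[of n] by simp
  qed
  have "summable (\<lambda>n. measure M (A n))"
  proof (rule summable_comparison_test')
    show "summable (\<lambda>n. 2 * (1 / 2 :: real) ^ n)" by (intro summable_mult summable_geometric) simp
    show "norm (measure M (A n)) \<le> 2 * (1 / 2) ^ n" if "0 \<le> n" for n using mA by simp
  qed
  then have "AE \<omega> in M. eventually (\<lambda>n. \<omega> \<in> space M - A n) sequentially"
    using A by (intro borel_cantelli_AE1) (auto simp: M.emeasure_eq_measure)
  then have "AE \<omega> in M. \<exists>N. \<forall>n\<ge>N. (\<forall>ps\<in>paths n n. 1 / t * n \<le> fpp_length \<omega> ps) \<and>
    (\<forall>k\<le>n. \<forall>ps\<in>paths n k. fpp_length \<omega> ps \<le> C * n)"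
  proof (rule AE_mp[OF _ AE_I2], intro impI)
    fix \<omega> assume "\<omega> \<in> space M" "eventually (\<lambda>n. \<omega> \<in> space M - A n) sequentially"
    then obtain N where N: "\<And>n. N \<le> n \<Longrightarrow> \<omega> \<in> space M - A n" by (auto simp: eventually_sequentially)
    have "1 / t * n \<le> fpp_length \<omega> ps" if "N \<le> n" "ps \<in> paths n n" for n ps
    proof -
      have "\<omega> \<notin> Lo n ps" using N that by (auto simp: A_def)
      then have "n < t * fpp_length \<omega> ps"
        using \<open>\<omega> \<in> space M\<close> path_edges(4)[OF that(2), of \<omega>] by (simp add: Lo_def not_le)
      then show ?thesis using t(1) by (simp add: field_simps)
    qed
    moreover have "fpp_length \<omega> ps \<le> C * n" if "N \<le> n" "k \<le> n" "ps \<in> paths n k" for n k ps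
    proof -
      have "\<omega> \<notin> Hi n ps" using N that by (auto simp: A_def)
      then show ?thesis using \<open>\<omega> \<in> space M\<close> path_edges(4)[OF that(3), of \<omega>] a
        by (simp add: Hi_def not_le mult.assoc)
    qed
    ultimately show "\<exists>N. \<forall>n\<ge>N. (\<forall>ps\<in>paths n n. 1 / t * n \<le> fpp_length \<omega> ps) \<and>
      (\<forall>k\<le>n. \<forall>ps\<in>paths n k. fpp_length \<omega> ps \<le> C * n)" by blast
  qed
  then show ?thesis
    using t(1) C unfolding fpp_measure_def M_def[symmetric]
    by (intro exI[of _ "1 / t"] conjI exI[of _ C]) auto
qed

end

theorem theorem1p13:
  fixes G :: "('a, 'b) monoid_scheme" and S :: "'a set" and \<rho> :: "real measure"
  assumes "group G"
    and "finite_symmetric_generating_set G S"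
    and "gromov_hyperbolic_group G S"
    and "\<not> elementary_group G"
    and "prob_space \<rho>"
    and "sets \<rho> = sets (restrict_space borel {0..})"
    and "\<forall>x\<in>space \<rho>. emeasure \<rho> {x} = 0"
    and "\<exists>a>0. (\<integral>\<^sup>+ x. ennreal (exp (a * x)) \<partial>\<rho>) < \<infinity>"
  shows "\<exists>\<Omega>\<^sub>2 \<in> sets (fpp_measure G S \<rho>). emeasure (fpp_measure G S \<rho>) \<Omega>\<^sub>2 = 1 \<and>
           (\<forall>\<omega>\<in>\<Omega>\<^sub>2. \<forall>\<xi>\<^sub>1\<in>gromov_boundary G S. \<forall>\<xi>\<^sub>2\<in>gromov_boundary G S. \<xi>\<^sub>1 \<noteq> \<xi>\<^sub>2 \<longrightarrow>
              (\<exists>p. bi_infinite_geodesic G S \<omega> p \<and> joins G S p \<xi>\<^sub>1 \<xi>\<^sub>2))"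
proof -
  interpret cayley_graph G S
    using assms(1,2) by (simp add: cayley_graph_def cayley_graph_axioms_def)
  interpret P: prob_space "fpp_measure G S \<rho>"
    unfolding fpp_measure_def by (rule prob_space_PiM) (rule assms)
  have sp: "space \<rho> = {0..}"
    using sets_eq_imp_space_eq[OF assms(6)] by (simp add: space_restrict_space)
  have id: "(\<lambda>x. x) \<in> borel_measurable \<rho>"
    using measurable_restrict_space1[of "\<lambda>x. x" borel borel "{0::real..}"]
    by (simp cong: measurable_cong_sets add: assms(6))
  have "{0} \<in> sets \<rho>" unfolding assms(6) by (subst sets_restrict_space_iff) auto
  moreover have "emeasure \<rho> {0} = 0" using assms(7) sp by simp
  ultimately obtain c C where c: "0 < c" "0 < C"
    and AE: "AE \<omega> in fpp_measure G S \<rho>. \<exists>N. \<forall>n\<ge>N.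
      (\<forall>ps\<in>paths n n. c * n \<le> fpp_length \<omega> ps) \<and>
      (\<forall>k\<le>n. \<forall>ps\<in>paths n k. fpp_length \<omega> ps \<le> C * n)"
    using AE_path_bounds[OF assms(5) sp id] assms(8) by blast
  define good where "good \<omega> \<longleftrightarrow> (\<exists>N. \<forall>n\<ge>N.
      (\<forall>ps\<in>paths n n. c * n \<le> fpp_length \<omega> ps) \<and>
      (\<forall>k\<le>n. \<forall>ps\<in>paths n k. fpp_length \<omega> ps \<le> C * n))" for \<omega>
  have "AE \<omega> in fpp_measure G S \<rho>. good \<omega>" using AE by (simp only: good_def)
  \<comment> \<open>The almost sure event is replaced by a measurable subset of full measure, fixed
    before any boundary points are given.\<close>
  then obtain \<Omega> where \<Omega>: "\<Omega> \<subseteq> {\<omega> \<in> space (fpp_measure G S \<rho>). good \<omega>}"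
    "\<Omega> \<in> sets (fpp_measure G S \<rho>)" "measure (fpp_measure G S \<rho>) \<Omega> = 1"
    by (rule P.AE_E_prob)
  obtain \<delta> where \<delta>: "0 \<le> \<delta>" "\<And>w x y z. w \<in> carrier G \<Longrightarrow> x \<in> carrier G \<Longrightarrow> y \<in> carrier G \<Longrightarrow>
      z \<in> carrier G \<Longrightarrow> min (gp w x y) (gp w y z) - \<delta> \<le> gp w x z"
    using assms(3) unfolding gromov_hyperbolic_group_def by blast
  have "\<exists>p. bi_infinite_geodesic G S \<omega> p \<and> joins G S p \<xi>\<^sub>1 \<xi>\<^sub>2"
    if \<omega>: "\<omega> \<in> \<Omega>" and \<xi>: "\<xi>\<^sub>1 \<in> gromov_boundary G S" "\<xi>\<^sub>2 \<in> gromov_boundary G S" "\<xi>\<^sub>1 \<noteq> \<xi>\<^sub>2" for \<omega> \<xi>\<^sub>1 \<xi>\<^sub>2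
  proof -
    have good: "good \<omega>" and space: "\<omega> \<in> space (fpp_measure G S \<rho>)" using \<omega> \<Omega>(1) by auto
    have nonneg: "0 \<le> \<omega> e" if "e \<in> cayley_edges G S" for e
      using space that sp by (auto simp: fpp_measure_def space_PiM PiE_iff)
    obtain N where N: "\<And>n ps. N \<le> n \<Longrightarrow> ps \<in> paths n n \<Longrightarrow> c * n \<le> fpp_length \<omega> ps"
      "\<And>n k ps. N \<le> n \<Longrightarrow> k \<le> n \<Longrightarrow> ps \<in> paths n k \<Longrightarrow> fpp_length \<omega> ps \<le> C * n"
      using good unfolding good_def by blast
    interpret regular_cayley_graph G S \<omega> N c C \<delta>
    proof
      fix n ps assume *: "N \<le> n" "edge_path G S ps" "distinct ps" "wd \<one>\<^bsub>G\<^esub> (hd ps) \<le> n"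
      then have "ps \<in> paths n (length ps - 1)" by (auto simp: paths_def edge_path_def Suc_diff_1)
      then show "length ps = Suc n \<Longrightarrow> c * n \<le> fpp_length \<omega> ps"
        "length ps \<le> Suc n \<Longrightarrow> fpp_length \<omega> ps \<le> C * n"
        using N(1)[OF *(1)] N(2)[OF *(1), of "length ps - 1" ps] by auto
    qed (use c \<delta> nonneg in auto)
    show ?thesis using ex_bi_infinite_geodesic[OF \<xi>] .
  qed
  then show ?thesis using \<Omega>(2,3) by (intro bexI[of _ \<Omega>]) (auto simp: P.emeasure_eq_measure)
qed

end
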